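(* Let $X,X_1,X_2,\ldots$ be real valued i.i.d. random variables with $0<\sigma^2=\mathrm{var}(X)<\infty$. For each $n\ge1$ let $(w_1^{(n)},\ldots,w_n^{(n)})$ have the multinomial distribution of size $m_n$ with probabilities $(\frac1n,\ldots,\frac1n)$, independent of the data (Efron's bootstrap). Put $$M_n=\frac{\max_{1\le i\le n}\big(\frac{w_i^{(n)}}{m_n}-\frac1n\big)^2}{\sum_{i=1}^n\big(\frac{w_i^{(n)}}{m_n}-\frac1n\big)^2},\quad V_{i,n}=\Big|\Big(\frac{w_i^{(n)}}{m_n}-\frac1n\Big)X_i\Big|,\quad V_n^2=\sum_{i=1}^n\Big(\frac{w_i^{(n)}}{m_n}-\frac1n\Big)^2,$$ and let $Z$ be standard normal. (a) If $m_n,n\to\infty$ in such a way that $m_n=o(n^2)$, then $M_n=o_{P_w}(1)$ is equivalent to having simultaneously $$P_{X|w}(T^*_{m_n}\le t)\to P(Z\le t)\ \text{ in probability-}P_w\ \text{ for all }t\in\mathbb R,\qquad \max_{1\le i\le n}P_{X|w}\big(V_{i,n}/(S_nV_n)>\varepsilon\big)=o_{P_w}(1)\ \text{ for all }\varepsilon>0,$$ and in particular $$P_{X|w}(T^*_{m_n}\le t)\to P(Z\le t)\ \text{ in probability-}P_w\ \text{ for all }t\in\mathbb R.$$ (b) If $m_n,n\to\infty$ in such a way that $m_n=o(n^2)$ and $n=o(m_n)$, then $M_n=o_{P_w}(1)$ is also equivalent to having simultaneously $$P_{X|w}(T^{**}_{m_n}\le t)\to P(Z\le t)\ \text{ in probability-}P_w\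 \text{ for all }t\in\mathbb R,\qquad \max_{1\le i\le n}P_{X|w}\big(V_{i,n}/(S^*_{m_n}/\sqrt{m_n})>\varepsilon\big)=o_{P_w}(1)\ \text{ for all }\varepsilon>0,$$ and in particular $$P_{X|w}(T^{**}_{m_n}\le t)\to P(Z\le t)\ \text{ in probability-}P_w\ \text{ for all }t\in\mathbb R.$$
   Context: $w_i^{(n)}$ is the number of times index $i$ is chosen in $m_n$ draws with replacement from $1,\dots,n$; the bootstrap sample is $X_1^*,\ldots,X_{m_n}^*$. The data live on $(\Omega_X,\mathcal F_X,P_X)$, the weights on $(\Omega_w,\mathcal F_w,P_w)$, and jointly on the product space. $P_{X|w}(\cdot)$ denotes conditional probability given $\sigma(w_1^{(n)},\ldots,w_n^{(n)})$. Put $\bar X_n=\frac1n\sum_{i=1}^nX_i$, $\bar X^*_{m_n}=\frac1{m_n}\sum_{i=1}^nw_i^{(n)}X_i$, $S_n^2=\frac1n\sum_{i=1}^n(X_i-\bar X_n)^2$, $S^{*2}_{m_n}=\frac1{m_n}\sum_{j=1}^{m_n}(X_j^*-\bar X^*_{m_n})^2=\frac1{m_n}\sum_{i=1}^nw_i^{(n)}(X_i-\bar X^*_{m_n})^2$, and $$T^*_{m_n}=\frac{\sum_{i=1}^n\big(\frac{w_i^{(n)}}{m_n}-\frac1n\big)X_i}{S_n\sqrt{\sum_{i=1}^n\big(\frac{w_i^{(n)}}{m_n}-\frac1n\big)^2}},\qquad T^{**}_{m_n}=\frac{\sum_{i=1}^n\big(\frac{w_i^{(n)}}{m_n}-\frac1n\big)X_i}{S^*_{m_n}/\sqrt{m_n}}.$$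 *)

theory Defs
  imports "HOL-Probability.Probability" "HOL-Library.Landau_Symbols"
begin

text \<open>
  The law of a random vector \<open>(W 1, \<dots>, W n)\<close> of counts is prescribed through its joint mass
  function on \<open>{k. k 1 + \<dots> + k n = N}\<close>; for \<open>p 1 + \<dots> + p n = 1\<close> these masses add up to 1.
\<close>

definition multinomial_distributed ::
    "'b measure \<Rightarrow> nat \<Rightarrow> nat \<Rightarrow> (nat \<Rightarrow> real) \<Rightarrow> (nat \<Rightarrow> 'b \<Rightarrow> nat) \<Rightarrow> bool" where
  "multinomial_distributed M n N p W \<longleftrightarrow>
     (\<forall>i\<in>{1..n}. W i \<in> measurable M (count_space UNIV)) \<and>
     (\<forall>k :: nat \<Rightarrow> nat. (\<Sum>i=1..n. k i) = N \<longrightarrow>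
        measure M {\<omega> \<in> space M. \<forall>i\<in>{1..n}. W i \<omega> = k i} =
          fact N / (\<Prod>i=1..n. fact (k i)) * (\<Prod>i=1..n. p i ^ k i))"

text \<open>
  Below, \<open>n\<close> is the sample size, \<open>N\<close> the number of draws, \<open>x\<close> the realised data
  \<open>x 1, \<dots>, x n\<close> and \<open>k\<close> the realised counts \<open>k 1, \<dots>, k n\<close>.
\<close>

definition centred_weight :: "nat \<Rightarrow> nat \<Rightarrow> (nat \<Rightarrow> nat) \<Rightarrow> nat \<Rightarrow> real" where
  "centred_weight n N k i = real (k i) / real N - 1 / real n"

definition sample_mean :: "nat \<Rightarrow> (nat \<Rightarrow> real) \<Rightarrow> real" where
  "sample_mean n x = (1 / real n) * (\<Sum>i=1..n. x i)"

definition sample_sd :: "nat \<Rightarrow> (nat \<Rightarrow> real) \<Rightarrow> real" where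
  "sample_sd n x = sqrt ((1 / real n) * (\<Sum>i=1..n. (x i - sample_mean n x)\<^sup>2))"

definition boot_mean :: "nat \<Rightarrow> nat \<Rightarrow> (nat \<Rightarrow> nat) \<Rightarrow> (nat \<Rightarrow> real) \<Rightarrow> real" where
  "boot_mean n N k x = (1 / real N) * (\<Sum>i=1..n. real (k i) * x i)"

definition boot_sd :: "nat \<Rightarrow> nat \<Rightarrow> (nat \<Rightarrow> nat) \<Rightarrow> (nat \<Rightarrow> real) \<Rightarrow> real" where
  "boot_sd n N k x =
     sqrt ((1 / real N) * (\<Sum>i=1..n. real (k i) * (x i - boot_mean n N k x)\<^sup>2))"

definition weight_norm :: "nat \<Rightarrow> nat \<Rightarrow> (nat \<Rightarrow> nat) \<Rightarrow> real" where
  "weight_norm n N k = sqrt (\<Sum>i=1..n. (centred_weight n N k i)\<^sup>2)"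

definition max_weight_ratio :: "nat \<Rightarrow> nat \<Rightarrow> (nat \<Rightarrow> nat) \<Rightarrow> real" where
  "max_weight_ratio n N k =
     (MAX i\<in>{1..n}. (centred_weight n N k i)\<^sup>2) / (\<Sum>i=1..n. (centred_weight n N k i)\<^sup>2)"

definition abs_summand :: "nat \<Rightarrow> nat \<Rightarrow> (nat \<Rightarrow> nat) \<Rightarrow> (nat \<Rightarrow> real) \<Rightarrow> nat \<Rightarrow> real" where
  "abs_summand n N k x i = \<bar>centred_weight n N k i * x i\<bar>"

definition T_star :: "nat \<Rightarrow> nat \<Rightarrow> (nat \<Rightarrow> nat) \<Rightarrow> (nat \<Rightarrow> real) \<Rightarrow> real" where
  "T_star n N k x =
     (\<Sum>i=1..n. centred_weight n N k i * x i) /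
       (sample_sd n x * sqrt (\<Sum>i=1..n. (centred_weight n N k i)\<^sup>2))"

definition T_star2 :: "nat \<Rightarrow> nat \<Rightarrow> (nat \<Rightarrow> nat) \<Rightarrow> (nat \<Rightarrow> real) \<Rightarrow> real" where
  "T_star2 n N k x =
     (\<Sum>i=1..n. centred_weight n N k i * x i) / (boot_sd n N k x / sqrt (real N))"

text \<open>
  \<open>weight_algebra PX Pw n W\<close> is \<open>\<sigma>(W 1, \<dots>, W n)\<close> on the product space, the \<open>W i\<close> being
  functions of the second coordinate, and \<open>cond_prob_weights\<close> is the conditional
  probability given it, as a random variable on the product space.
\<close>

definition weight_algebra ::
    "'a measure \<Rightarrow> 'b measure \<Rightarrow> nat \<Rightarrow> (nat \<Rightarrow> 'b \<Rightarrow> nat) \<Rightarrow> ('a \<times> 'b) measure" where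
  "weight_algebra PX Pw n W =
     vimage_algebra (space (PX \<Otimes>\<^sub>M Pw)) (\<lambda>z. \<lambda>i\<in>{1..n}. W i (snd z))
       (\<Pi>\<^sub>M i\<in>{1..n}. count_space UNIV)"

definition cond_prob_weights ::
    "'a measure \<Rightarrow> 'b measure \<Rightarrow> nat \<Rightarrow> (nat \<Rightarrow> 'b \<Rightarrow> nat) \<Rightarrow> ('a \<Rightarrow> 'b \<Rightarrow> bool) \<Rightarrow> 'a \<times> 'b \<Rightarrow> real" where
  "cond_prob_weights PX Pw n W Q =
     real_cond_exp (PX \<Otimes>\<^sub>M Pw) (weight_algebra PX Pw n W)
       (indicat_real {z \<in> space (PX \<Otimes>\<^sub>M Pw). Q (fst z) (snd z)})"

definition tendsto_in_prob :: "'c measure \<Rightarrow> (nat \<Rightarrow> 'c \<Rightarrow> real) \<Rightarrow> real \<Rightarrow> bool" where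
  "tendsto_in_prob M Y c \<longleftrightarrow>
     (\<forall>\<epsilon>>0. (\<lambda>n. measure M {\<omega> \<in> space M. \<bar>Y n \<omega> - c\<bar> > \<epsilon>}) \<longlonglongrightarrow> 0)"

text \<open>
  Convergence in probability-\<open>Pw\<close> of conditional probabilities given the weights is expressed
  by \<^const>\<open>tendsto_in_prob\<close> on the product space. This is convergence with respect to \<open>Pw\<close>,
  because on \<^const>\<open>weight_algebra\<close> the product measure is \<open>Pw\<close>:
\<close>

lemma weight_algebra_eq:
  "A \<in> sets (weight_algebra PX Pw n W) \<longleftrightarrow>
     (\<exists>B \<in> sets (\<Pi>\<^sub>M i\<in>{1..n}. count_space UNIV).
        A = {z \<in> space (PX \<Otimes>\<^sub>M Pw). (\<lambda>i\<in>{1..n}. W i (snd z)) \<in> B})"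
  unfolding weight_algebra_def
  by (subst sets_vimage_algebra2) (auto simp: space_PiM)

lemma measurable_weight_vector:
  assumes "\<And>i. i \<in> {1..n} \<Longrightarrow> W i \<in> measurable Pw (count_space UNIV)"
  shows "(\<lambda>\<omega>. \<lambda>i\<in>{1..n}. W i \<omega>) \<in> measurable Pw (\<Pi>\<^sub>M i\<in>{1..n}. count_space UNIV)"
  using assms by (intro measurable_restrict) auto

lemma subalgebra_weight_algebra:
  assumes "\<And>i. i \<in> {1..n} \<Longrightarrow> W i \<in> measurable Pw (count_space UNIV)"
  shows "subalgebra (PX \<Otimes>\<^sub>M Pw) (weight_algebra PX Pw n W)"
proof -
  have "(\<lambda>z. \<lambda>i\<in>{1..n}. W i (snd z))
      \<in> measurable (PX \<Otimes>\<^sub>M Pw) (\<Pi>\<^sub>M i\<in>{1..n}. count_space UNIV)"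
    using measurable_compose[OF measurable_snd measurable_weight_vector[OF assms]] .
  then have "A \<in> sets (PX \<Otimes>\<^sub>M Pw)" if "A \<in> sets (weight_algebra PX Pw n W)" for A
    using that unfolding weight_algebra_eq
    by (auto dest!: measurable_sets simp: vimage_def Int_def conj_commute)
  then show ?thesis
    by (auto simp: subalgebra_def weight_algebra_def)
qed

lemma measure_weight_algebra:
  assumes "prob_space PX" "prob_space Pw"
    and W: "\<And>i. i \<in> {1..n} \<Longrightarrow> W i \<in> measurable Pw (count_space UNIV)"
    and A: "A \<in> sets (weight_algebra PX Pw n W)" and x: "x \<in> space PX"
  shows "measure (PX \<Otimes>\<^sub>M Pw) A = measure Pw {\<omega> \<in> space Pw. (x, \<omega>) \<in> A}"
proof -
  interpret PX: prob_space PX by fact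
  interpret Pw: prob_space Pw by fact
  obtain B where B: "B \<in> sets (\<Pi>\<^sub>M i\<in>{1..n}. count_space UNIV)"
    and AB: "A = {z \<in> space (PX \<Otimes>\<^sub>M Pw). (\<lambda>i\<in>{1..n}. W i (snd z)) \<in> B}"
    using A unfolding weight_algebra_eq by blast
  define C where "C = {\<omega> \<in> space Pw. (\<lambda>i\<in>{1..n}. W i \<omega>) \<in> B}"
  have C: "C \<in> sets Pw"
    using measurable_sets[OF measurable_weight_vector[of n W Pw] B] W
    by (simp add: C_def vimage_def Int_def conj_commute)
  have "A = space PX \<times> C"
    unfolding AB C_def by (auto simp: space_pair_measure)
  then have "emeasure (PX \<Otimes>\<^sub>M Pw) A = emeasure Pw C"
    using C by (simp add: Pw.emeasure_pair_measure_Times PX.emeasure_space_1)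
  moreover have "{\<omega> \<in> space Pw. (x, \<omega>) \<in> A} = C"
    using x unfolding AB C_def by (auto simp: space_pair_measure)
  ultimately show ?thesis
    by (simp add: measure_def)
qed

end

theory Submission
  imports Defs "HOL-Combinatorics.Multiset_Permutations"
begin

text \<open>
  Each of the five assertions in the two equivalences is established by itself: the
  negligibility of the weights, the two conditional central limit theorems and the two conditional
  negligibility conditions. The equivalences then hold because both of their sides do.

  Write \<open>c i = w i / N - 1 / n\<close> for the centred weights, with \<open>N = m n\<close>, and \<open>V\<close> for their Euclidean
  norm. A multinomial vector is the vector of counts of \<open>N\<close> independent uniform draws from
  \<open>{1..n}\<close>, and adding the draws one at a time gives the moments that matter. The
  statistic \<open>N * V ^ 2\<close>, Pearson's chi-square divided by \<open>n\<close>, has mean \<open>1 - 1 / n\<close> and variance at most \<open>2 / n\<close>, hence is close to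
  \<open>1\<close>. The fourth moment of \<open>N * c i\<close> is at most \<open>N / n + 3 * N ^ 2 / n ^ 2\<close>, so a union bound over
  \<open>i\<close> shows that the maximum of \<open>N * (c i) ^ 2\<close> is close to \<open>0\<close>. Together these say that
  \<^const>\<open>max_weight_ratio\<close> tends to \<open>0\<close> and \<open>N * V ^ 2\<close> to \<open>1\<close> in probability; both are recorded in
  the single quantity \<open>weight_defect\<close> (lemma \<open>tendsto_weight_defect\<close>).

  The weights are discrete and independent of the data, so by Fubini the conditional probability
  of an event given the weights is the probability under \<open>PX\<close> of that event with the counts held
  fixed (\<open>cond_prob_weights_eq\<close>). It therefore suffices to prove limit theorems for the data along
  deterministic sequences of counts whose \<open>weight_defect\<close> tends to \<open>0\<close>; allowing arbitrary
  sample sizes along the sequence covers subsequences, and a contradiction argument then yields the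
  uniformity that convergence in probability asks for (\<open>uniform_on_good_counts\<close>).

  For fixed counts both statistics have the form \<open>(\<Sum>i. c i * X i) / (\<tau> * V)\<close>. As the \<open>c i\<close>
  sum to \<open>0\<close>, the data may be centred, and \<open>weighted_clt\<close>, a Lindeberg theorem for sums with
  normalised and uniformly small coefficients \<open>c i / V\<close>, gives the normal limit of the numerator. The
  factor \<open>\<tau>\<close> is the sample standard deviation or \<open>boot_sd / (sqrt N * V)\<close>. Each standard deviation
  comes from weighted averages of \<open>X i\<close> and \<open>(X i) ^ 2\<close>, with weights \<open>1 / n\<close> or \<open>w i / N\<close>, and
  \<open>weighted_weak_law\<close> shows that it tends to the standard deviation of \<open>X\<close>. Because
  \<open>sqrt N * V\<close> tends to \<open>1\<close>, the same holds for \<open>\<tau>\<close> in both cases. Slutsky's theorem gives the normal limits, and Markov's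
  inequality gives the negligibility of the single summands.
\<close>

section \<open>Moments of the counts of uniform draws\<close>

definition draws :: "nat \<Rightarrow> nat \<Rightarrow> nat list set" where
  "draws n N = {xs. set xs \<subseteq> {1..n} \<and> length xs = N}"

text \<open>
  Expectation under the uniform law on the lists of \<open>N\<close> draws, as a plain finite sum, so that
  moments can be computed by adding one draw at a time (lemma \<open>avg_Suc\<close>).
\<close>

definition avg :: "nat \<Rightarrow> nat \<Rightarrow> (nat list \<Rightarrow> real) \<Rightarrow> real" where
  "avg n N f = (\<Sum>xs\<in>draws n N. f xs) / real n ^ N"

lemma finite_draws [simp]: "finite (draws n N)"
  unfolding draws_def by (rule finite_lists_length_eq) simp

lemma card_draws: "card (draws n N) = n ^ N"
  unfolding draws_def by (simp add: card_lists_length_eq)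

lemma draws_0: "draws n 0 = {[]}"
  by (auto simp: draws_def)

lemma draws_Suc: "draws n (Suc N) = (\<lambda>(xs, d). d # xs) ` (draws n N \<times> {1..n})"
  by (auto simp: draws_def length_Suc_conv image_iff)

lemma avg_0: "avg n 0 f = f []"
  by (simp add: avg_def draws_0)

lemma avg_Suc:
  "avg n (Suc N) f = avg n N (\<lambda>xs. (\<Sum>d=1..n. f (d # xs)) / real n)"
proof -
  have "inj_on (\<lambda>(xs, d). d # xs) (draws n N \<times> {1..n})"
    by (auto simp: inj_on_def)
  then have "(\<Sum>xs\<in>draws n (Suc N). f xs) = (\<Sum>xs\<in>draws n N. \<Sum>d=1..n. f (d # xs))"
    unfolding draws_Suc by (simp add: sum.reindex sum.cartesian_product case_prod_unfold o_def)
  then show ?thesis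
    by (simp add: avg_def sum_divide_distrib[symmetric] field_simps)
qed

lemma avg_cong: "(\<And>xs. xs \<in> draws n N \<Longrightarrow> f xs = g xs) \<Longrightarrow> avg n N f = avg n N g"
  by (simp add: avg_def)

lemma avg_add: "avg n N (\<lambda>xs. f xs + g xs) = avg n N f + avg n N g"
  by (simp add: avg_def sum.distrib add_divide_distrib)

lemma avg_diff: "avg n N (\<lambda>xs. f xs - g xs) = avg n N f - avg n N g"
  by (simp add: avg_def sum_subtractf diff_divide_distrib)

lemma avg_cmult: "avg n N (\<lambda>xs. c * f xs) = c * avg n N f"
  by (simp add: avg_def sum_distrib_left)

lemma avg_sum: "avg n N (\<lambda>xs. \<Sum>i\<in>I. f i xs) = (\<Sum>i\<in>I. avg n N (f i))"
  by (simp add: avg_def sum_divide_distrib sum.swap[of _ I])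

lemma avg_const: "n \<ge> 1 \<Longrightarrow> avg n N (\<lambda>_. c) = c"
  by (simp add: avg_def card_draws)

lemma avg_mono: "(\<And>xs. xs \<in> draws n N \<Longrightarrow> f xs \<le> g xs) \<Longrightarrow> avg n N f \<le> avg n N g"
  unfolding avg_def by (intro divide_right_mono sum_mono) auto

definition dev :: "nat \<Rightarrow> nat list \<Rightarrow> nat \<Rightarrow> real" where
  "dev n xs i = real (count_list xs i) - real (length xs) / real n"

text \<open>
  This is \<open>N / n\<close> times Pearson's chi-square statistic of the counts.
\<close>

definition dev_sq :: "nat \<Rightarrow> nat list \<Rightarrow> real" where
  "dev_sq n xs = (\<Sum>i=1..n. (dev n xs i)\<^sup>2)"

lemma sum_count_list: "xs \<in> draws n N \<Longrightarrow> (\<Sum>i=1..n. count_list xs i) = N"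
  using sum_count_set[of xs "{1..n}"] by (auto simp: draws_def)

lemma sum_dev: "n \<ge> 1 \<Longrightarrow> xs \<in> draws n N \<Longrightarrow> (\<Sum>i=1..n. dev n xs i) = 0"
  using sum_count_list[of xs n N]
  by (simp add: dev_def sum_subtractf flip: of_nat_sum) (simp add: draws_def)

lemma dev_Cons: "dev n (d # xs) i = dev n xs i + ((if d = i then 1 else 0) - 1 / real n)"
  by (simp add: dev_def add_divide_distrib)

text \<open>
  One further draw moves \<open>dev i\<close> by \<open>1 - 1 / n\<close> with probability \<open>1 / n\<close> and by \<open>- 1 / n\<close>
  otherwise.
\<close>

lemma sum_pow_indicator:
  fixes z :: real
  assumes i: "i \<in> {1..n}"
  shows "(\<Sum>d=1..n. (z + ((if d = i then 1 else 0) - 1 / real n)) ^ p) / real n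
     = (1 / real n) * (z + (1 - 1 / real n)) ^ p + (1 - 1 / real n) * (z - 1 / real n) ^ p"
proof -
  have "(\<Sum>d=1..n. (z + ((if d = i then 1 else 0) - 1 / real n)) ^ p)
    = (z + (1 - 1 / real n)) ^ p + (\<Sum>d\<in>{1..n} - {i}. (z - 1 / real n) ^ p)"
    using i by (subst sum.remove[of _ i]) (auto intro!: sum.cong)
  also have "\<dots> = (z + (1 - 1 / real n)) ^ p + (real n - 1) * (z - 1 / real n) ^ p"
    using i by (simp add: of_nat_diff)
  finally show ?thesis
    using i by (simp add: field_simps)
qed

lemma avg_dev_sq_single:
  assumes i: "i \<in> {1..n}"
  shows "avg n N (\<lambda>xs. (dev n xs i)\<^sup>2) = real N * (1 / real n * (1 - 1 / real n))"
proof (induction N)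
  case (Suc N)
  have "((1 / real n) * (z + (1 - 1 / real n))\<^sup>2 + (1 - 1 / real n) * (z - 1 / real n)\<^sup>2)
    = z\<^sup>2 + 1 / real n * (1 - 1 / real n)" for z :: real
    by algebra
  then have "avg n (Suc N) (\<lambda>xs. (dev n xs i)\<^sup>2)
      = avg n N (\<lambda>xs. (dev n xs i)\<^sup>2 + 1 / real n * (1 - 1 / real n))"
    unfolding avg_Suc dev_Cons sum_pow_indicator[OF i] by simp
  also have "\<dots> = avg n N (\<lambda>xs. (dev n xs i)\<^sup>2) + 1 / real n * (1 - 1 / real n)"
    using i by (simp only: avg_add) (simp add: avg_const)
  finally show ?case
    unfolding Suc by (simp add: algebra_simps add_divide_distrib)
qed (simp add: avg_0 dev_def)

text \<open>
  A further draw adds an independent centred increment \<open>\<xi>\<close> to \<open>z = dev i\<close>. In the expansion of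
  \<open>(z + \<xi>) ^ 4\<close> the terms that are linear in \<open>z\<close> or in \<open>\<xi>\<close> average out, so the fourth moment grows by
  \<open>6 * E (z ^ 2) * E (\<xi> ^ 2) + E (\<xi> ^ 4)\<close>, where \<open>E (z ^ 2)\<close> is known and the last term is at
  most \<open>1 / n\<close>.
\<close>

lemma avg_dev_pow4:
  assumes i: "i \<in> {1..n}"
  shows "avg n N (\<lambda>xs. (dev n xs i) ^ 4) \<le> real N / real n + 3 * (real N)\<^sup>2 / (real n)\<^sup>2"
proof (induction N)
  case (Suc N)
  define q where "q = 1 / real n"
  have q: "0 < q" "q \<le> 1" using i by (auto simp: q_def)
  define v where "v = q * (1 - q)"
  define f where "f = q * (1 - q) ^ 4 + (1 - q) * q ^ 4"
  define h where "h = 4 * (q * (1 - q) ^ 3 - (1 - q) * q ^ 3)"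
  have expand: "(q * (z + (1 - q)) ^ 4 + (1 - q) * (z - q) ^ 4) = z ^ 4 + 6 * v * z\<^sup>2 + h * z + f" for z :: real
    unfolding v_def f_def h_def by algebra
  have mean: "avg n N (\<lambda>xs. dev n xs i) = 0"
  proof (induction N)
    case (Suc N)
    have "(1 / real n) * (z + (1 - 1 / real n)) ^ 1 + (1 - 1 / real n) * (z - 1 / real n) ^ 1 = z"
      for z :: real
      by (simp add: algebra_simps add_divide_distrib)
    then show ?case
      using Suc unfolding avg_Suc dev_Cons
      by (simp only: sum_pow_indicator[OF i, of _ 1, unfolded power_one_right] power_one_right)
  qed (simp add: avg_0 dev_def)
  have "v \<le> q" "0 \<le> v"
    using q by (auto simp: v_def algebra_simps)
  have "f \<le> q"
  proof -
    have "f = v * ((1-q)^3 + q^3)" unfolding f_def v_def by algebra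
    also have "\<dots> \<le> v * ((1 - q) + q)"
      using q \<open>0 \<le> v\<close> power_decreasing[of 1 3 q] power_decreasing[of 1 3 "1 - q"]
      by (intro mult_left_mono) auto
    finally show ?thesis using \<open>v \<le> q\<close> by simp
  qed
  have "avg n (Suc N) (\<lambda>xs. (dev n xs i) ^ 4)
     = avg n N (\<lambda>xs. dev n xs i ^ 4) + 6 * v * (real N * v) + f"
    unfolding avg_Suc dev_Cons sum_pow_indicator[OF i] unfolding q_def[symmetric] expand
    using i by (simp only: avg_add avg_cmult mean avg_dev_sq_single[OF i, of N] q_def[symmetric])
      (simp add: v_def avg_const)
  also have "\<dots> \<le> (real N * q + 3 * (real N)\<^sup>2 * q\<^sup>2) + 6 * q * (real N * q) + q"
    using Suc \<open>f \<le> q\<close> \<open>v \<le> q\<close> \<open>0 \<le> v\<close> q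
    by (intro add_mono mult_mono mult_nonneg_nonneg) (auto simp: q_def power_divide)
  also have "\<dots> \<le> real (Suc N) * q + 3 * (real (Suc N))\<^sup>2 * q\<^sup>2"
    by (simp add: algebra_simps power2_eq_square)
  finally show ?case
    by (simp add: q_def power_divide)
qed (simp add: avg_0 dev_def)

text \<open>
  The increment is linear in \<open>dev d\<close> because the deviations sum to \<open>0\<close>.
\<close>

lemma dev_sq_Cons:
  assumes n: "n \<ge> 1" and d: "d \<in> {1..n}" and xs: "xs \<in> draws n N"
  shows "dev_sq n (d # xs) = dev_sq n xs + 2 * dev n xs d + (1 - 1 / real n)"
proof -
  have "dev_sq n (d # xs) = (\<Sum>i=1..n. (dev n xs i)\<^sup>2 + 2 * (if d = i then dev n xs i else 0)
     + (- 2 / real n) * dev n xs i + (if d = i then 1 - 2 / real n else 0) + 1 / (real n)\<^sup>2)"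
    unfolding dev_sq_def dev_Cons
    by (intro sum.cong) (auto simp: power2_eq_square algebra_simps)
  also have "\<dots> = dev_sq n xs + 2 * dev n xs d + (- 2 / real n) * (\<Sum>i=1..n. dev n xs i)
      + (1 - 2 / real n) + real n * (1 / (real n)\<^sup>2)"
    using d by (simp only: sum.distrib flip: sum_distrib_left) (simp add: dev_sq_def)
  also have "real n * (1 / (real n)\<^sup>2) = 1 / real n"
    using n by (simp add: power2_eq_square)
  finally show ?thesis
    using n sum_dev[OF n xs] by (simp add: algebra_simps add_divide_distrib)
qed

lemma avg_dev_sq:
  assumes n: "n \<ge> 1"
  shows "avg n N (dev_sq n) = real N * (1 - 1 / real n)"
proof -
  have "avg n N (dev_sq n) = (\<Sum>i=1..n. avg n N (\<lambda>xs. (dev n xs i)\<^sup>2))"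
    unfolding dev_sq_def avg_sum ..
  also have "\<dots> = (\<Sum>i=1..n. real N * (1 / real n * (1 - 1 / real n)))"
    by (intro sum.cong refl avg_dev_sq_single)
  finally show ?thesis using n by simp
qed

text \<open>
  After centring, \<open>dev_sq\<close> is a martingale in the number of draws: by \<open>dev_sq_Cons\<close> its increment is
  \<open>2 * dev d\<close>, which averages to \<open>0\<close> over \<open>d\<close> and has mean square \<open>4 * dev_sq / n\<close>. Summing the
  averages of these mean squares gives the variance.
\<close>

lemma avg_dev_sq_variance:
  assumes n: "n \<ge> 1"
  shows "avg n N (\<lambda>xs. (dev_sq n xs - real N * (1 - 1 / real n))\<^sup>2) \<le> 2 * (real N)\<^sup>2 / real n"
proof (induction N)
  case (Suc N)
  define Y where "Y xs = dev_sq n xs - real N * (1 - 1 / real n)" for xs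
  have step: "(\<Sum>d=1..n. (dev_sq n (d # xs) - real (Suc N) * (1 - 1 / real n))\<^sup>2) / real n
    = (Y xs)\<^sup>2 + 4 / real n * dev_sq n xs" if xs: "xs \<in> draws n N" for xs
  proof -
    have "(\<Sum>d=1..n. (dev_sq n (d # xs) - real (Suc N) * (1 - 1 / real n))\<^sup>2)
      = (\<Sum>d=1..n. (Y xs)\<^sup>2 + 4 * Y xs * dev n xs d + 4 * (dev n xs d)\<^sup>2)"
    proof (intro sum.cong refl)
      fix d assume d: "d \<in> {1..n}"
      have "dev_sq n (d # xs) - real (Suc N) * (1 - 1 / real n) = Y xs + 2 * dev n xs d"
        unfolding dev_sq_Cons[OF n d xs] Y_def by (simp add: algebra_simps add_divide_distrib)
      then show "(dev_sq n (d # xs) - real (Suc N) * (1 - 1 / real n))\<^sup>2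
          = (Y xs)\<^sup>2 + 4 * Y xs * dev n xs d + 4 * (dev n xs d)\<^sup>2"
        by (simp add: power2_eq_square algebra_simps)
    qed
    also have "\<dots> = real n * (Y xs)\<^sup>2 + 4 * dev_sq n xs"
      using sum_dev[OF n xs] by (simp add: sum.distrib dev_sq_def flip: sum_distrib_left)
    finally show ?thesis using n by (simp add: field_simps)
  qed
  have "avg n (Suc N) (\<lambda>xs. (dev_sq n xs - real (Suc N) * (1 - 1 / real n))\<^sup>2)
     = avg n N (\<lambda>xs. (Y xs)\<^sup>2 + 4 / real n * dev_sq n xs)"
    unfolding avg_Suc by (intro avg_cong step)
  also have "\<dots> = avg n N (\<lambda>xs. (Y xs)\<^sup>2) + 4 / real n * (real N * (1 - 1 / real n))"
    by (simp only: avg_add avg_cmult avg_dev_sq[OF n])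
  also have "\<dots> \<le> 2 * (real N)\<^sup>2 / real n + 4 / real n * (real N * 1)"
    using Suc n by (intro add_mono mult_left_mono) (auto simp: Y_def)
  also have "\<dots> \<le> 2 * (real (Suc N))\<^sup>2 / real n"
    using n by (simp add: field_simps power2_eq_square)
  finally show ?case .
qed (simp add: avg_0 dev_def dev_sq_def)

lemma avg_markov:
  assumes "\<And>xs. xs \<in> draws n N \<Longrightarrow> 0 \<le> f xs" and "c > 0"
  shows "avg n N (\<lambda>xs. of_bool (f xs > c)) \<le> avg n N f / c"
proof -
  have "avg n N (\<lambda>xs. of_bool (f xs > c)) \<le> avg n N (\<lambda>xs. (1 / c) * f xs)"
    using assms by (intro avg_mono) (auto simp: field_simps)
  then show ?thesis by (simp only: avg_cmult) simp
qed

text \<open>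
  The lists with prescribed counts are the permutations of one multiset.
\<close>

lemma card_draws_counts:
  assumes k: "(\<Sum>i=1..n. k i) = N"
  shows "real (card {xs \<in> draws n N. \<forall>i\<in>{1..n}. count_list xs i = k i})
    = fact N / (\<Prod>i=1..n. fact (k i))"
proof -
  define A where "A = (\<Sum>i\<in>{1..n}. replicate_mset (k i) i)"
  have count_A: "count A i = (if i \<in> {1..n} then k i else 0)" for i
    unfolding A_def count_sum by simp
  have size_A: "size A = N"
    using k by (simp add: A_def size_multiset_sum)
  have set_A: "set_mset A \<subseteq> {1..n}"
  proof
    fix i assume "i \<in># A"
    then have "count A i > 0" by simp
    then show "i \<in> {1..n}" by (simp add: count_A split: if_splits)
  qed
  have "{xs \<in> draws n N. \<forall>i\<in>{1..n}. count_list xs i = k i} = permutations_of_multiset A"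
  proof (intro equalityI subsetI)
    fix xs assume xs: "xs \<in> {xs \<in> draws n N. \<forall>i\<in>{1..n}. count_list xs i = k i}"
    have "mset xs = A"
    proof (rule multiset_eqI)
      fix i
      show "count (mset xs) i = count A i"
        using xs by (cases "i \<in> {1..n}")
          (auto simp: count_A count_mset draws_def count_list_0_iff)
    qed
    then show "xs \<in> permutations_of_multiset A" by (simp add: permutations_of_multiset_def)
  next
    fix xs assume "xs \<in> permutations_of_multiset A"
    then have xs: "mset xs = A" by (simp add: permutations_of_multiset_def)
    then show "xs \<in> {xs \<in> draws n N. \<forall>i\<in>{1..n}. count_list xs i = k i}"
      using set_A size_A count_A by (auto simp flip: count_mset simp: draws_def)
  qed
  moreover have "(\<Prod>i\<in>set_mset A. fact (count A i) :: nat) = (\<Prod>i=1..n. fact (k i))"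
    using set_A count_A by (intro prod.mono_neutral_cong_left) (auto simp: not_in_iff)
  ultimately have "card {xs \<in> draws n N. \<forall>i\<in>{1..n}. count_list xs i = k i} *
      (\<Prod>i=1..n. fact (k i)) = fact N"
    using card_permutations_of_multiset_aux[of A] size_A by simp
  then have "real (card {xs \<in> draws n N. \<forall>i\<in>{1..n}. count_list xs i = k i} *
      (\<Prod>i=1..n. fact (k i))) = real (fact N)"
    by (rule arg_cong)
  then have "real (card {xs \<in> draws n N. \<forall>i\<in>{1..n}. count_list xs i = k i}) *
      (\<Prod>i=1..n. fact (k i)) = fact N"
    by (simp only: of_nat_mult of_nat_prod of_nat_fact)
  moreover have "(\<Prod>i=1..n. fact (k i) :: real) \<noteq> 0"
    by simp
  ultimately show ?thesis
    by (simp add: eq_divide_eq)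
qed

section \<open>Multinomial vectors as counts of uniform draws\<close>

text \<open>
  A weight vector with \<open>n\<close> entries is a function on all of \<^typ>\<open>nat\<close> whose values outside
  \<open>{1..n}\<close> are arbitrary, so events and statistics are required to ignore those values.
\<close>

definition determined_on :: "nat \<Rightarrow> ((nat \<Rightarrow> nat) \<Rightarrow> 'c) \<Rightarrow> bool" where
  "determined_on n g \<longleftrightarrow> (\<forall>k k'. (\<forall>i\<in>{1..n}. k i = k' i) \<longrightarrow> g k = g k')"

lemma determined_onD: "determined_on n g \<Longrightarrow> (\<And>i. i \<in> {1..n} \<Longrightarrow> k i = k' i) \<Longrightarrow> g k = g k'"
  by (auto simp: determined_on_def)

lemma determined_on_compose: "determined_on n g \<Longrightarrow> determined_on n (\<lambda>k. f (g k))"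
  unfolding determined_on_def by metis

lemma determined_on_compose2:
  assumes "determined_on n f" "determined_on n g"
  shows "determined_on n (\<lambda>k. h (f k) (g k))"
  using assms unfolding determined_on_def by metis

text \<open>
  A finite product of copies of \<open>count_space UNIV\<close> on \<^typ>\<open>nat\<close> is again discrete.
\<close>

lemma sets_count_event:
  assumes W: "\<And>i. i \<in> {1..n} \<Longrightarrow> W i \<in> measurable M (count_space UNIV)"
    and Q: "determined_on n Q"
  shows "{\<omega> \<in> space M. Q (\<lambda>i. W i \<omega>)} \<in> sets M"
proof -
  have "{v \<in> {1..n} \<rightarrow>\<^sub>E UNIV. Q v} \<in> sets (\<Pi>\<^sub>M i\<in>{1..n}. count_space (UNIV :: nat set))"
    by (subst count_space_PiM_finite) auto
  from measurable_sets[OF measurable_weight_vector[OF W] this]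
  have "(\<lambda>\<omega>. \<lambda>i\<in>{1..n}. W i \<omega>) -` {v \<in> {1..n} \<rightarrow>\<^sub>E UNIV. Q v} \<inter> space M \<in> sets M" .
  also have "(\<lambda>\<omega>. \<lambda>i\<in>{1..n}. W i \<omega>) -` {v \<in> {1..n} \<rightarrow>\<^sub>E UNIV. Q v} \<inter> space M
      = {\<omega> \<in> space M. Q (\<lambda>i. W i \<omega>)}"
  proof -
    have "Q (\<lambda>i\<in>{1..n}. W i \<omega>) = Q (\<lambda>i. W i \<omega>)" for \<omega>
      by (rule determined_onD[OF Q]) simp
    then show ?thesis by auto
  qed
  finally show ?thesis .
qed

lemma avg_of_bool: "avg n N (\<lambda>xs. of_bool (Q xs)) = card {xs \<in> draws n N. Q xs} / real n ^ N"
  by (simp add: avg_def of_bool_def sum.If_cases Int_def)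

text \<open>
  The count vectors attained by lists satisfying \<open>Q\<close> give finitely many disjoint events, whose
  probabilities are prescribed by the multinomial law and counted by \<open>card_draws_counts\<close>.
\<close>

lemma multinomial_ge_avg:
  assumes "prob_space M" and W: "multinomial_distributed M n N (\<lambda>_. 1 / real n) W"
    and n: "n \<ge> 1" and Q: "determined_on n Q"
  shows "avg n N (\<lambda>xs. of_bool (Q (count_list xs))) \<le> measure M {\<omega> \<in> space M. Q (\<lambda>i. W i \<omega>)}"
proof -
  interpret prob_space M by fact
  have Wm: "\<And>i. i \<in> {1..n} \<Longrightarrow> W i \<in> measurable M (count_space UNIV)"
    and mass: "\<And>k. (\<Sum>i=1..n. k i) = N \<Longrightarrow> prob {\<omega> \<in> space M. \<forall>i\<in>{1..n}. W i \<omega> = k i} =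
          fact N / (\<Prod>i=1..n. fact (k i)) * (\<Prod>i=1..n. (1 / real n) ^ k i)"
    using W by (auto simp: multinomial_distributed_def)
  define D where "D = {xs \<in> draws n N. Q (count_list xs)}"
  have D: "finite D" by (simp add: D_def)
  define r where "r xs = (\<lambda>i\<in>{1..n}. count_list xs i)" for xs
  define E where "E k = {\<omega> \<in> space M. \<forall>i\<in>{1..n}. W i \<omega> = k i}" for k :: "nat \<Rightarrow> nat"
  have E_sets: "E k \<in> sets M" for k
    unfolding E_def by (rule sets_count_event[OF Wm]) (auto simp: determined_on_def)
  have E_prob: "prob (E k) = real (card {xs \<in> D. r xs = k}) / real n ^ N" if k: "k \<in> r ` D" for k
  proof -
    obtain xs where xs: "xs \<in> D" "k = r xs" using k by auto
    have sum_k: "(\<Sum>i=1..n. k i) = N"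
      using sum_count_list[of xs n N] xs by (simp add: r_def D_def)
    have "Q (count_list ys) = Q (count_list xs)" if "\<forall>i\<in>{1..n}. count_list ys i = k i" for ys
      using that xs by (intro determined_onD[OF Q]) (simp add: r_def)
    moreover have "r ys = k \<longleftrightarrow> (\<forall>i\<in>{1..n}. count_list ys i = k i)" for ys
      unfolding xs(2) r_def by (auto simp: fun_eq_iff restrict_def)
    ultimately have "{ys \<in> D. r ys = k} = {ys \<in> draws n N. \<forall>i\<in>{1..n}. count_list ys i = k i}"
      using xs(1) by (auto simp only: D_def)
    moreover have "(\<Prod>i=1..n. (1 / real n) ^ k i) = 1 / real n ^ N"
      unfolding power_sum[symmetric] sum_k by (rule power_one_over)
    ultimately show ?thesis
      unfolding E_def mass[OF sum_k] using card_draws_counts[OF sum_k] by simp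
  qed
  have "real (card D) = (\<Sum>k\<in>r ` D. real (card {xs \<in> D. r xs = k}))"
    using sum.image_gen[OF D, of "\<lambda>_. 1 :: real" r] by simp
  then have "avg n N (\<lambda>xs. of_bool (Q (count_list xs))) = (\<Sum>k\<in>r ` D. prob (E k))"
    unfolding avg_of_bool D_def[symmetric] by (simp add: E_prob sum_divide_distrib)
  also have "\<dots> = prob (\<Union>k\<in>r ` D. E k)"
  proof (rule finite_measure_finite_Union[symmetric])
    show "disjoint_family_on E (r ` D)"
    proof (unfold disjoint_family_on_def, intro ballI impI)
      fix k k' assume "k \<in> r ` D" "k' \<in> r ` D" "k \<noteq> k'"
      moreover from this have "k \<in> extensional {1..n}" "k' \<in> extensional {1..n}"
        by (auto simp: r_def)
      ultimately obtain i where "i \<in> {1..n}" "k i \<noteq> k' i"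
        using extensionalityI[of k "{1..n}" k'] by blast
      then show "E k \<inter> E k' = {}" by (auto simp: E_def)
    qed
  qed (use D E_sets in auto)
  also have "\<dots> \<le> prob {\<omega> \<in> space M. Q (\<lambda>i. W i \<omega>)}"
  proof (rule finite_measure_mono)
    have "Q (\<lambda>i. W i \<omega>) = Q (count_list xs)" if "\<forall>i\<in>{1..n}. W i \<omega> = count_list xs i" for \<omega> xs
      using that by (intro determined_onD[OF Q]) simp
    then show "(\<Union>k\<in>r ` D. E k) \<subseteq> {\<omega> \<in> space M. Q (\<lambda>i. W i \<omega>)}"
      by (auto simp: E_def r_def D_def)
  qed (rule sets_count_event[OF Wm Q])
  finally show ?thesis .
qed

text \<open>
  The lower bound \<open>multinomial_ge_avg\<close> for \<open>Q\<close> and for its negation adds up to \<open>1\<close>, hence both are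
  equalities.
\<close>

lemma multinomial_eq_avg:
  assumes M: "prob_space M" and W: "multinomial_distributed M n N (\<lambda>_. 1 / real n) W"
    and n: "n \<ge> 1" and Q: "determined_on n Q"
  shows "measure M {\<omega> \<in> space M. Q (\<lambda>i. W i \<omega>)} = avg n N (\<lambda>xs. of_bool (Q (count_list xs)))"
proof (rule antisym)
  interpret prob_space M by fact
  have Wm: "\<And>i. i \<in> {1..n} \<Longrightarrow> W i \<in> measurable M (count_space UNIV)"
    using W by (auto simp: multinomial_distributed_def)
  have nQ: "determined_on n (\<lambda>k. \<not> Q k)"
    using Q by (simp add: determined_on_def)
  have "avg n N (\<lambda>xs. of_bool (\<not> Q (count_list xs))) = avg n N (\<lambda>xs. 1 - of_bool (Q (count_list xs)))"
    by (intro avg_cong) simp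
  also have "\<dots> = 1 - avg n N (\<lambda>xs. of_bool (Q (count_list xs)))"
    using n by (simp only: avg_diff avg_const)
  finally have "1 - avg n N (\<lambda>xs. of_bool (Q (count_list xs)))
      \<le> prob {\<omega> \<in> space M. \<not> Q (\<lambda>i. W i \<omega>)}"
    using multinomial_ge_avg[OF M W n nQ] by simp
  also have "\<dots> = 1 - prob {\<omega> \<in> space M. Q (\<lambda>i. W i \<omega>)}"
    by (rule prob_neg[OF sets_count_event[OF Wm Q]])
  finally show "prob {\<omega> \<in> space M. Q (\<lambda>i. W i \<omega>)} \<le> avg n N (\<lambda>xs. of_bool (Q (count_list xs)))"
    by simp
qed (rule multinomial_ge_avg[OF assms])

lemma multinomial_sum:
  assumes M: "prob_space M" and W: "multinomial_distributed M n N (\<lambda>_. 1 / real n) W" and n: "n \<ge> 1"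
  shows "AE \<omega> in M. (\<Sum>i=1..n. W i \<omega>) = N"
proof -
  interpret prob_space M by fact
  have Wm: "\<And>i. i \<in> {1..n} \<Longrightarrow> W i \<in> measurable M (count_space UNIV)"
    using W by (auto simp: multinomial_distributed_def)
  have Q: "determined_on n (\<lambda>k. (\<Sum>i=1..n. k i) = N)"
    by (auto simp: determined_on_def)
  have "avg n N (\<lambda>xs. of_bool ((\<Sum>i=1..n. count_list xs i) = N)) = avg n N (\<lambda>xs. 1)"
    using sum_count_list by (intro avg_cong) simp
  then have "prob {\<omega> \<in> space M. (\<Sum>i=1..n. W i \<omega>) = N} = 1"
    using multinomial_eq_avg[OF M W n Q] n by (simp add: avg_const)
  then show ?thesis
    using prob_eq_1[OF sets_count_event[OF Wm Q]] by auto
qed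

section \<open>Convergence in probability and weak convergence\<close>

lemma tendsto_in_probI:
  assumes "\<And>\<epsilon> \<eta>. \<epsilon> > 0 \<Longrightarrow> \<eta> > 0 \<Longrightarrow>
    \<forall>\<^sub>F n in sequentially. measure M {\<omega> \<in> space M. \<bar>Y n \<omega> - c\<bar> > \<epsilon>} < \<eta>"
  shows "tendsto_in_prob M Y c"
  unfolding tendsto_in_prob_def
proof (intro allI impI order_tendstoI)
  fix \<epsilon> a :: real assume "a < 0"
  then have "a < measure M {\<omega> \<in> space M. \<bar>Y n \<omega> - c\<bar> > \<epsilon>}" for n
    by (rule less_le_trans) simp
  then show "\<forall>\<^sub>F n in sequentially. a < measure M {\<omega> \<in> space M. \<bar>Y n \<omega> - c\<bar> > \<epsilon>}"
    by (intro always_eventually allI)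
qed (use assms in auto)

lemma tendsto_in_probD:
  "tendsto_in_prob M Y c \<Longrightarrow> \<epsilon> > 0 \<Longrightarrow>
    (\<lambda>n. measure M {\<omega> \<in> space M. \<bar>Y n \<omega> - c\<bar> > \<epsilon>}) \<longlonglongrightarrow> 0"
  by (auto simp: tendsto_in_prob_def)

lemma (in prob_space) tendsto_in_prob_isCont2:
  assumes [measurable]: "\<And>n. A n \<in> borel_measurable M" "\<And>n. B n \<in> borel_measurable M"
    and A: "tendsto_in_prob M A a" and B: "tendsto_in_prob M B b"
    and f: "isCont (\<lambda>z. f (fst z) (snd z)) (a, b)"
  shows "tendsto_in_prob M (\<lambda>n \<omega>. f (A n \<omega>) (B n \<omega>) :: real) (f a b)"
  unfolding tendsto_in_prob_def
proof (intro allI impI)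
  fix \<epsilon> :: real assume "\<epsilon> > 0"
  then obtain d where d: "d > 0" "\<And>z. dist z (a, b) < d \<Longrightarrow> dist (f (fst z) (snd z)) (f a b) < \<epsilon>"
    using f unfolding continuous_at_eps_delta by fastforce
  define e where "e = d / 3"
  have "e > 0" using d by (simp add: e_def)
  have sub: "\<bar>f u v - f a b\<bar> < \<epsilon>" if "\<bar>u - a\<bar> \<le> e" "\<bar>v - b\<bar> \<le> e" for u v
  proof -
    have "dist (u, v) (a, b) \<le> \<bar>u - a\<bar> + \<bar>v - b\<bar>"
      using sqrt_sum_squares_le_sum_abs by (simp add: dist_Pair_Pair dist_real_def)
    also have "\<dots> < d" using that \<open>e > 0\<close> by (simp add: e_def)
    finally show ?thesis using d(2)[of "(u, v)"] by (simp add: dist_real_def)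
  qed
  have "(\<lambda>n. prob {\<omega> \<in> space M. \<bar>A n \<omega> - a\<bar> > e} + prob {\<omega> \<in> space M. \<bar>B n \<omega> - b\<bar> > e})
      \<longlonglongrightarrow> 0 + 0"
    using A B \<open>e > 0\<close> by (intro tendsto_add tendsto_in_probD)
  then have lim: "(\<lambda>n. prob {\<omega> \<in> space M. \<bar>A n \<omega> - a\<bar> > e} + prob {\<omega> \<in> space M. \<bar>B n \<omega> - b\<bar> > e})
      \<longlonglongrightarrow> 0"
    by simp
  have "prob {\<omega> \<in> space M. \<bar>f (A n \<omega>) (B n \<omega>) - f a b\<bar> > \<epsilon>}
      \<le> prob {\<omega> \<in> space M. \<bar>A n \<omega> - a\<bar> > e} + prob {\<omega> \<in> space M. \<bar>B n \<omega> - b\<bar> > e}" for n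
  proof -
    have "prob {\<omega> \<in> space M. \<bar>f (A n \<omega>) (B n \<omega>) - f a b\<bar> > \<epsilon>}
      \<le> prob ({\<omega> \<in> space M. \<bar>A n \<omega> - a\<bar> > e} \<union> {\<omega> \<in> space M. \<bar>B n \<omega> - b\<bar> > e})"
    proof (intro finite_measure_mono subsetI)
      fix \<omega> assume *: "\<omega> \<in> {\<omega> \<in> space M. \<bar>f (A n \<omega>) (B n \<omega>) - f a b\<bar> > \<epsilon>}"
      then have "\<not> (\<bar>A n \<omega> - a\<bar> \<le> e \<and> \<bar>B n \<omega> - b\<bar> \<le> e)"
        using sub[of "A n \<omega>" "B n \<omega>"] by auto
      then show "\<omega> \<in> {\<omega> \<in> space M. \<bar>A n \<omega> - a\<bar> > e} \<union> {\<omega> \<in> space M. \<bar>B n \<omega> - b\<bar> > e}"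
        using * by auto
    qed simp
    also have "\<dots> \<le> prob {\<omega> \<in> space M. \<bar>A n \<omega> - a\<bar> > e} + prob {\<omega> \<in> space M. \<bar>B n \<omega> - b\<bar> > e}"
      by (intro measure_Un_le) auto
    finally show ?thesis .
  qed
  then show "(\<lambda>n. prob {\<omega> \<in> space M. \<bar>f (A n \<omega>) (B n \<omega>) - f a b\<bar> > \<epsilon>}) \<longlonglongrightarrow> 0"
    by (intro tendsto_sandwich[OF always_eventually always_eventually tendsto_const lim] allI) auto
qed

lemma (in prob_space) tendsto_in_prob_const:
  assumes "r \<longlonglongrightarrow> c"
  shows "tendsto_in_prob M (\<lambda>n _. r n) c"
  unfolding tendsto_in_prob_def
proof (intro allI impI)
  fix \<epsilon> :: real assume "\<epsilon> > 0"
  have "\<forall>\<^sub>F n in sequentially. \<bar>r n - c\<bar> < \<epsilon>"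
    using assms \<open>\<epsilon> > 0\<close> by (auto simp: tendsto_iff dist_real_def)
  then show "(\<lambda>n. prob {\<omega> \<in> space M. \<bar>r n - c\<bar> > \<epsilon>}) \<longlonglongrightarrow> 0"
    by (intro tendsto_eventually) (auto elim!: eventually_mono)
qed

text \<open>
  The upper bound on \<open>exp (- y)\<close> comes from \<open>exp y \<ge> 1 + y + y\<^sup>2 / 2\<close> and
  \<open>(1 + y + y\<^sup>2 / 2) * (1 - y + y\<^sup>2 / 2) = 1 + y ^ 4 / 4\<close>.
\<close>

lemma exp_minus_approx:
  fixes y :: real
  assumes "y \<ge> 0"
  shows "\<bar>exp (- y) - (1 - y)\<bar> \<le> y\<^sup>2 / 2"
proof -
  have pos: "1 + y + y\<^sup>2 / 2 > 0" using assms by (intro add_pos_nonneg) auto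
  have "1 \<le> (1 - y + y\<^sup>2 / 2) * (1 + y + y\<^sup>2 / 2)"
  proof -
    have "(1 - y + y\<^sup>2 / 2) * (1 + y + y\<^sup>2 / 2) = 1 + (y\<^sup>2)\<^sup>2 / 4"
      by (simp add: power2_eq_square algebra_simps)
    then show ?thesis by simp
  qed
  then have "1 / (1 + y + y\<^sup>2 / 2) \<le> 1 - y + y\<^sup>2 / 2"
    using pos by (simp add: pos_divide_le_eq)
  moreover have "exp (- y) \<le> 1 / (1 + y + y\<^sup>2 / 2)"
    unfolding exp_minus inverse_eq_divide
    using pos exp_lower_Taylor_quadratic[OF assms] by (intro divide_left_mono) auto
  moreover have "1 - y \<le> exp (- y)"
    using exp_ge_add_one_self[of "- y"] by simp
  ultimately show ?thesis by (simp add: abs_le_iff)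
qed

lemma continuous_cdf_std_normal: "isCont (cdf std_normal_distribution) t"
proof -
  interpret real_distribution std_normal_distribution by (rule real_dist_normal_dist)
  have "emeasure std_normal_distribution {t} = 0"
    by (subst emeasure_density) (auto intro!: nn_integral_null_set)
  then show ?thesis by (simp add: isCont_cdf measure_def)
qed

text \<open>
  On the event \<open>\<bar>\<tau> - \<sigma>\<bar> \<le> \<delta>\<close>, whose probability tends to \<open>1\<close>, the quotient is at most \<open>t\<close> iff
  \<open>Y \<le> t * \<tau> / \<sigma>\<close>, and this bound lies within \<open>v = \<bar>t\<bar> * \<delta> / \<sigma>\<close> of \<open>t\<close>. Continuity of the limiting
  distribution function makes the resulting gap small.
\<close>

lemma (in prob_space) slutsky_quotient:
  assumes Y [measurable]: "\<And>j. Y j \<in> borel_measurable M" and \<tau> [measurable]: "\<And>j. \<tau> j \<in> borel_measurable M"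
    and conv: "weak_conv_m (\<lambda>j. distr M borel (Y j)) N" and N: "\<And>u. isCont (cdf N) u"
    and \<tau>: "tendsto_in_prob M \<tau> \<sigma>" and \<sigma>: "\<sigma> > 0"
  shows "(\<lambda>j. prob {x \<in> space M. \<sigma> * Y j x / \<tau> j x \<le> t}) \<longlonglongrightarrow> cdf N t"
proof -
  define F where "F j u = prob {x \<in> space M. Y j x \<le> u}" for j u
  have F: "(\<lambda>j. F j u) \<longlonglongrightarrow> cdf N u" for u
    using conv N unfolding weak_conv_m_def weak_conv_def F_def
    by (simp add: cdf_def measure_distr vimage_def Int_def conj_commute)
  show ?thesis
    unfolding tendsto_iff
  proof (intro allI impI)
    fix \<eta> :: real assume "\<eta> > 0"
    then obtain d where d: "d > 0" "\<And>u. \<bar>u - t\<bar> < d \<Longrightarrow> \<bar>cdf N u - cdf N t\<bar> < \<eta> / 3"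
      using N[of t] unfolding continuous_at_eps_delta dist_real_def by (metis divide_pos_pos zero_less_numeral)
    \<comment> \<open>The first bound keeps \<open>\<tau>\<close> positive and the second gives \<open>v < d\<close>; the summand \<open>1\<close> covers \<open>t = 0\<close>.\<close>
    define \<delta> where "\<delta> = min (\<sigma> / 2) (d * \<sigma> / (2 * (\<bar>t\<bar> + 1)))"
    have \<delta>: "0 < \<delta>" "\<delta> < \<sigma>" using \<sigma> d by (auto simp: \<delta>_def)
    define v where "v = \<bar>t\<bar> * \<delta> / \<sigma>"
    have "v \<ge> 0" using \<delta> \<sigma> by (simp add: v_def)
    have "v < d"
    proof -
      have "\<bar>t\<bar> * \<delta> \<le> (\<bar>t\<bar> + 1) * (d * \<sigma> / (2 * (\<bar>t\<bar> + 1)))"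
        using \<delta> by (intro mult_mono) (auto simp: \<delta>_def)
      also have "\<dots> = d * \<sigma> / 2" by (simp add: field_simps)
      also have "\<dots> < d * \<sigma>" using d \<sigma> by simp
      finally show ?thesis using \<sigma> by (simp add: v_def pos_divide_less_eq)
    qed
    define R where "R j = prob {x \<in> space M. \<bar>\<tau> j x - \<sigma>\<bar> > \<delta>}" for j
    have "R \<longlonglongrightarrow> 0" unfolding R_def using \<tau> \<delta> by (intro tendsto_in_probD)
    have close: "\<bar>t * \<tau> j x / \<sigma> - t\<bar> \<le> v" "\<tau> j x > 0" if "\<bar>\<tau> j x - \<sigma>\<bar> \<le> \<delta>" for j x
    proof -
      have "t * \<tau> j x / \<sigma> - t = t * (\<tau> j x - \<sigma>) / \<sigma>" using \<sigma> by (simp add: field_simps)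
      then have "\<bar>t * \<tau> j x / \<sigma> - t\<bar> = \<bar>t\<bar> * \<bar>\<tau> j x - \<sigma>\<bar> / \<sigma>" using \<sigma> by (simp add: abs_mult)
      also have "\<dots> \<le> v" unfolding v_def using that \<sigma> by (intro divide_right_mono mult_left_mono) auto
      finally show "\<bar>t * \<tau> j x / \<sigma> - t\<bar> \<le> v" .
      show "\<tau> j x > 0" using that \<delta> by linarith
    qed
    have iff: "\<sigma> * Y j x / \<tau> j x \<le> t \<longleftrightarrow> Y j x \<le> t * \<tau> j x / \<sigma>" if "\<bar>\<tau> j x - \<sigma>\<bar> \<le> \<delta>" for j x
      using close(2)[OF that] \<sigma> by (simp add: pos_divide_le_eq pos_le_divide_eq mult.commute)
    have upper: "prob {x \<in> space M. \<sigma> * Y j x / \<tau> j x \<le> t} \<le> F j (t + v) + R j" for j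
    proof -
      have "prob {x \<in> space M. \<sigma> * Y j x / \<tau> j x \<le> t}
        \<le> prob ({x \<in> space M. Y j x \<le> t + v} \<union> {x \<in> space M. \<bar>\<tau> j x - \<sigma>\<bar> > \<delta>})"
      proof (rule finite_measure_mono)
        show "{x \<in> space M. \<sigma> * Y j x / \<tau> j x \<le> t}
          \<subseteq> {x \<in> space M. Y j x \<le> t + v} \<union> {x \<in> space M. \<bar>\<tau> j x - \<sigma>\<bar> > \<delta>}"
        proof
          fix x assume "x \<in> {x \<in> space M. \<sigma> * Y j x / \<tau> j x \<le> t}"
          then show "x \<in> {x \<in> space M. Y j x \<le> t + v} \<union> {x \<in> space M. \<bar>\<tau> j x - \<sigma>\<bar> > \<delta>}"
            using iff[of j x] close(1)[of j x] by (cases "\<bar>\<tau> j x - \<sigma>\<bar> \<le> \<delta>") auto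
        qed
      qed simp
      also have "\<dots> \<le> F j (t + v) + R j" unfolding F_def R_def by (intro measure_Un_le) auto
      finally show ?thesis .
    qed
    have lower: "F j (t - v) - R j \<le> prob {x \<in> space M. \<sigma> * Y j x / \<tau> j x \<le> t}" for j
    proof -
      have "F j (t - v) \<le> prob ({x \<in> space M. \<sigma> * Y j x / \<tau> j x \<le> t} \<union> {x \<in> space M. \<bar>\<tau> j x - \<sigma>\<bar> > \<delta>})"
        unfolding F_def
      proof (rule finite_measure_mono)
        show "{x \<in> space M. Y j x \<le> t - v}
          \<subseteq> {x \<in> space M. \<sigma> * Y j x / \<tau> j x \<le> t} \<union> {x \<in> space M. \<bar>\<tau> j x - \<sigma>\<bar> > \<delta>}"
        proof
          fix x assume "x \<in> {x \<in> space M. Y j x \<le> t - v}"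
          then show "x \<in> {x \<in> space M. \<sigma> * Y j x / \<tau> j x \<le> t} \<union> {x \<in> space M. \<bar>\<tau> j x - \<sigma>\<bar> > \<delta>}"
            using iff[of j x] close(1)[of j x] by (cases "\<bar>\<tau> j x - \<sigma>\<bar> \<le> \<delta>") (auto simp: abs_le_iff)
        qed
      qed simp
      also have "\<dots> \<le> prob {x \<in> space M. \<sigma> * Y j x / \<tau> j x \<le> t} + R j"
        unfolding R_def by (intro measure_Un_le) auto
      finally show ?thesis by simp
    qed
    have "\<forall>\<^sub>F j in sequentially. R j < \<eta> / 3 \<and> \<bar>F j (t + v) - cdf N (t + v)\<bar> < \<eta> / 3 \<and>
        \<bar>F j (t - v) - cdf N (t - v)\<bar> < \<eta> / 3"
      using order_tendstoD(2)[OF \<open>R \<longlonglongrightarrow> 0\<close>, of "\<eta> / 3"] \<open>\<eta> > 0\<close>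
        tendstoD[OF F[of "t + v"], of "\<eta> / 3"] tendstoD[OF F[of "t - v"], of "\<eta> / 3"]
      unfolding dist_real_def by (intro eventually_conj) simp_all
    then show "\<forall>\<^sub>F j in sequentially. dist (prob {x \<in> space M. \<sigma> * Y j x / \<tau> j x \<le> t}) (cdf N t) < \<eta>"
    proof eventually_elim
      case (elim j)
      have "\<bar>cdf N (t + v) - cdf N t\<bar> < \<eta> / 3" "\<bar>cdf N (t - v) - cdf N t\<bar> < \<eta> / 3"
        using d(2) \<open>v \<ge> 0\<close> \<open>v < d\<close> by auto
      then show ?case using elim upper[of j] lower[of j] unfolding dist_real_def by linarith
    qed
  qed
qed

section \<open>Size of the centred weights\<close>

text \<open>
  A single number that is small exactly when the largest weight is negligible and
  \<open>N * (weight_norm n N k)\<^sup>2\<close> is close to \<open>1\<close>; besides the sum of the counts it is all that the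
  limit theorems use of the weights.
\<close>

definition weight_defect :: "nat \<Rightarrow> nat \<Rightarrow> (nat \<Rightarrow> nat) \<Rightarrow> real" where
  "weight_defect n N k =
     max_weight_ratio n N k + \<bar>real N * (\<Sum>i=1..n. (centred_weight n N k i)\<^sup>2) - 1\<bar>"

lemma max_weight_ratio_nonneg: "n \<ge> 1 \<Longrightarrow> 0 \<le> max_weight_ratio n N k"
  unfolding max_weight_ratio_def
  by (intro divide_nonneg_nonneg sum_nonneg) (auto simp: Max_ge_iff intro!: bexI[of _ 1])

text \<open>
  The two bounds keep \<open>(dev i)\<^sup>2\<close> below \<open>\<delta> * N / 4\<close> and \<open>dev_sq\<close> within \<open>\<delta> * N / 4\<close> of its mean,
  which is itself within \<open>\<delta> * N / 4\<close> of \<open>N\<close>. Thus \<open>dev_sq \<ge> N / 2\<close>, and each of the two summands of the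
  defect is at most \<open>\<delta> / 2\<close>.
\<close>

lemma weight_defect_bound:
  assumes n: "n \<ge> 1" and N: "N \<ge> 1" and \<delta>: "0 < \<delta>" "\<delta> \<le> 1" "4 / real n \<le> \<delta>"
    and xs: "xs \<in> draws n N"
    and dev4: "\<And>i. i \<in> {1..n} \<Longrightarrow> dev n xs i ^ 4 \<le> (\<delta> * real N / 4)\<^sup>2"
    and sq: "(dev_sq n xs - real N * (1 - 1 / real n))\<^sup>2 \<le> (\<delta> * real N / 4)\<^sup>2"
  shows "weight_defect n N (count_list xs) \<le> \<delta>"
proof -
  have cw: "centred_weight n N (count_list xs) i = dev n xs i / real N" for i
    using N xs by (simp add: centred_weight_def dev_def draws_def diff_divide_distrib)
  have sum_cw: "(\<Sum>i=1..n. (centred_weight n N (count_list xs) i)\<^sup>2) = dev_sq n xs / (real N)\<^sup>2"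
    by (simp add: cw dev_sq_def power_divide sum_divide_distrib)
  have dev2: "(dev n xs i)\<^sup>2 \<le> \<delta> * real N / 4" if "i \<in> {1..n}" for i
  proof (rule power2_le_imp_le)
    show "((dev n xs i)\<^sup>2)\<^sup>2 \<le> (\<delta> * real N / 4)\<^sup>2"
      using dev4[OF that] by (simp flip: power_mult)
  qed (use \<delta> in simp)
  have abs: "\<bar>dev_sq n xs - real N * (1 - 1 / real n)\<bar> \<le> \<delta> * real N / 4"
    using sq \<delta> by (simp only: abs_le_square_iff[symmetric]) simp
  have "real N * (4 / real n) \<le> real N * \<delta>"
    using \<delta> by (intro mult_left_mono) auto
  then have "real N / real n \<le> \<delta> * real N / 4" by (simp add: mult.commute)
  moreover have "0 \<le> real N / real n" by simp
  moreover have "real N * (1 - 1 / real n) = real N - real N / real n" by (simp add: right_diff_distrib)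
  ultimately have abs': "\<bar>dev_sq n xs - real N\<bar> \<le> \<delta> * real N / 2"
    using abs by linarith
  have "\<delta> * real N \<le> 1 * real N" using \<delta> by (intro mult_right_mono) auto
  then have half: "real N / 2 \<le> dev_sq n xs" using abs' by linarith
  have "max_weight_ratio n N (count_list xs) \<le> (\<delta> * real N / 4 / (real N)\<^sup>2) / (real N / 2 / (real N)\<^sup>2)"
    unfolding max_weight_ratio_def sum_cw
  proof (rule frac_le)
    show "(MAX i\<in>{1..n}. (centred_weight n N (count_list xs) i)\<^sup>2) \<le> \<delta> * real N / 4 / (real N)\<^sup>2"
      unfolding cw power_divide
      using n divide_right_mono[OF dev2, of _ "(real N)\<^sup>2"] by (subst Max_le_iff) auto
    show "real N / 2 / (real N)\<^sup>2 \<le> dev_sq n xs / (real N)\<^sup>2"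
      using half by (rule divide_right_mono) simp
  qed (use N \<delta> in auto)
  also have "\<dots> = \<delta> / 2" using N by (simp add: field_simps)
  finally have 1: "max_weight_ratio n N (count_list xs) \<le> \<delta> / 2" .
  have "real N * (dev_sq n xs / (real N)\<^sup>2) - 1 = (dev_sq n xs - real N) / real N"
    using N by (simp add: power2_eq_square field_simps)
  then have "\<bar>real N * (dev_sq n xs / (real N)\<^sup>2) - 1\<bar> \<le> \<delta> / 2"
    using divide_right_mono[OF abs', of "real N"] N by (simp add: abs_divide)
  then show ?thesis
    using 1 unfolding weight_defect_def sum_cw by linarith
qed

lemma determined_on_weight_defect: "determined_on n (\<lambda>k. weight_defect n N k > c)"
proof -
  have "weight_defect n N k = weight_defect n N k'" if "\<forall>i\<in>{1..n}. k i = k' i" for k k' :: "nat \<Rightarrow> nat"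
  proof -
    have "centred_weight n N k i = centred_weight n N k' i" if "i \<in> {1..n}" for i
      using that \<open>\<forall>i\<in>{1..n}. k i = k' i\<close> by (simp add: centred_weight_def)
    then have "(\<Sum>i=1..n. (centred_weight n N k i)\<^sup>2) = (\<Sum>i=1..n. (centred_weight n N k' i)\<^sup>2)"
      and "(\<lambda>i. (centred_weight n N k i)\<^sup>2) ` {1..n} = (\<lambda>i. (centred_weight n N k' i)\<^sup>2) ` {1..n}"
      by (auto intro!: sum.cong image_cong)
    then show ?thesis unfolding weight_defect_def max_weight_ratio_def by presburger
  qed
  then show ?thesis by (simp add: determined_on_def) metis
qed

text \<open>
  Union bound and Markov's inequality for the fourth moments of the deviations and the
  variance of \<open>dev_sq\<close>. The sum of the fourth moments is of order \<open>N + N ^ 2 / n\<close>, which is small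
  compared with \<open>N ^ 2\<close>.
\<close>

lemma prob_weight_defect:
  assumes M: "prob_space M" and W: "multinomial_distributed M n N (\<lambda>_. 1 / real n) W"
    and n: "n \<ge> 1" and N: "N \<ge> 1" and \<delta>: "0 < \<delta>" "\<delta> \<le> 1" "4 / real n \<le> \<delta>"
  shows "measure M {\<omega> \<in> space M. weight_defect n N (\<lambda>i. W i \<omega>) > \<delta>}
      \<le> 16 / \<delta>\<^sup>2 * (1 / real N + 5 / real n)"
proof -
  define c where "c = (\<delta> * real N / 4)\<^sup>2"
  have c: "c > 0" using N \<delta> by (simp add: c_def)
  have "measure M {\<omega> \<in> space M. weight_defect n N (\<lambda>i. W i \<omega>) > \<delta>}
      = avg n N (\<lambda>xs. of_bool (weight_defect n N (count_list xs) > \<delta>))"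
    by (rule multinomial_eq_avg[OF M W n determined_on_weight_defect])
  also have "\<dots> \<le> avg n N (\<lambda>xs. (\<Sum>i=1..n. of_bool (dev n xs i ^ 4 > c))
      + of_bool ((dev_sq n xs - real N * (1 - 1 / real n))\<^sup>2 > c))"
  proof (rule avg_mono)
    fix xs assume xs: "xs \<in> draws n N"
    show "of_bool (weight_defect n N (count_list xs) > \<delta>) \<le> (\<Sum>i=1..n. of_bool (dev n xs i ^ 4 > c))
      + (of_bool ((dev_sq n xs - real N * (1 - 1 / real n))\<^sup>2 > c) :: real)"
    proof (cases "(\<exists>i\<in>{1..n}. dev n xs i ^ 4 > c) \<or> (dev_sq n xs - real N * (1 - 1 / real n))\<^sup>2 > c")
      case False
      then have "weight_defect n N (count_list xs) \<le> \<delta>"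
        unfolding c_def by (intro weight_defect_bound[OF n N \<delta> xs]) (auto simp: not_less)
      then show ?thesis by (auto simp: sum_nonneg)
    next
      case True
      have "1 \<le> (\<Sum>i=1..n. of_bool (dev n xs i ^ 4 > c) :: real)" if "i \<in> {1..n}" "dev n xs i ^ 4 > c" for i
        using member_le_sum[OF that(1), of "\<lambda>i. of_bool (dev n xs i ^ 4 > c) :: real"] that by simp
      moreover have "0 \<le> (\<Sum>i=1..n. of_bool (dev n xs i ^ 4 > c) :: real)"
        by (intro sum_nonneg) auto
      ultimately show ?thesis using True by (auto simp: of_bool_def)
    qed
  qed
  also have "\<dots> = (\<Sum>i=1..n. avg n N (\<lambda>xs. of_bool (dev n xs i ^ 4 > c)))
      + avg n N (\<lambda>xs. of_bool ((dev_sq n xs - real N * (1 - 1 / real n))\<^sup>2 > c))"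
    by (simp only: avg_add avg_sum)
  also have "\<dots> \<le> (\<Sum>i=1..n. (real N / real n + 3 * (real N)\<^sup>2 / (real n)\<^sup>2) / c)
      + 2 * (real N)\<^sup>2 / real n / c"
  proof (intro add_mono sum_mono)
    show "avg n N (\<lambda>xs. of_bool (dev n xs i ^ 4 > c))
        \<le> (real N / real n + 3 * (real N)\<^sup>2 / (real n)\<^sup>2) / c" if "i \<in> {1..n}" for i
      using c by (intro order_trans[OF avg_markov[OF _ c] divide_right_mono[OF avg_dev_pow4[OF that]]]) auto
    show "avg n N (\<lambda>xs. of_bool ((dev_sq n xs - real N * (1 - 1 / real n))\<^sup>2 > c))
        \<le> 2 * (real N)\<^sup>2 / real n / c"
      using c by (intro order_trans[OF avg_markov[OF _ c] divide_right_mono[OF avg_dev_sq_variance[OF n]]]) auto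
  qed
  also have "\<dots> = (real N + 5 * ((real N)\<^sup>2 / real n)) / c"
    using n by (simp add: add_divide_distrib distrib_left power2_eq_square)
  also have "\<dots> = 16 / \<delta>\<^sup>2 * ((real N + 5 * ((real N)\<^sup>2 / real n)) / (real N)\<^sup>2)"
    by (simp add: c_def power_mult_distrib power_divide)
  also have "(real N + 5 * ((real N)\<^sup>2 / real n)) / (real N)\<^sup>2 = 1 / real N + 5 / real n"
    using N by (simp add: add_divide_distrib power2_eq_square)
  finally show ?thesis .
qed

lemma tendsto_weight_defect:
  assumes M: "prob_space M"
    and W: "\<And>n. n \<ge> 1 \<Longrightarrow> multinomial_distributed M n (m n) (\<lambda>_. 1 / real n) (w n)"
    and m: "filterlim m at_top sequentially"
  shows "tendsto_in_prob M (\<lambda>n \<omega>. weight_defect n (m n) (\<lambda>i. w n i \<omega>)) 0"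
  unfolding tendsto_in_prob_def
proof (intro allI impI)
  fix \<epsilon> :: real assume "\<epsilon> > 0"
  interpret prob_space M by fact
  \<comment> \<open>The tail bound for the defect is stated for thresholds of at most \<open>1\<close>.\<close>
  define \<delta> where "\<delta> = min \<epsilon> 1"
  have \<delta>: "0 < \<delta>" "\<delta> \<le> 1" using \<open>\<epsilon> > 0\<close> by (auto simp: \<delta>_def)
  have inv_n: "(\<lambda>n. c / real n) \<longlonglongrightarrow> 0" for c
    by (rule lim_const_over_n)
  have inv_m: "(\<lambda>n. 1 / real (m n)) \<longlonglongrightarrow> 0"
    using filterlim_compose[OF lim_const_over_n m, of 1] .
  have ev: "\<forall>\<^sub>F n in sequentially. n \<ge> 1 \<and> m n \<ge> 1 \<and> 4 / real n < \<delta>"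
    using eventually_ge_at_top[of 1] m \<delta> order_tendstoD(2)[OF inv_n, of \<delta> 4]
    by (auto simp: filterlim_at_top intro!: eventually_conj)
  show "(\<lambda>n. prob {\<omega> \<in> space M. \<bar>weight_defect n (m n) (\<lambda>i. w n i \<omega>) - 0\<bar> > \<epsilon>}) \<longlonglongrightarrow> 0"
  proof (rule tendsto_sandwich[OF _ _ tendsto_const])
    show "\<forall>\<^sub>F n in sequentially. prob {\<omega> \<in> space M. \<bar>weight_defect n (m n) (\<lambda>i. w n i \<omega>) - 0\<bar> > \<epsilon>}
        \<le> 16 / \<delta>\<^sup>2 * (1 / real (m n) + 5 / real n)"
      using ev
    proof eventually_elim
      case (elim n)
      then have n: "n \<ge> 1" and mn: "m n \<ge> 1" and "4 / real n \<le> \<delta>" by auto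
      have Wm: "\<And>i. i \<in> {1..n} \<Longrightarrow> w n i \<in> measurable M (count_space UNIV)"
        using W[OF n] by (auto simp: multinomial_distributed_def)
      have "0 \<le> weight_defect n (m n) k" for k
        using max_weight_ratio_nonneg[OF n] by (simp add: weight_defect_def)
      then have "prob {\<omega> \<in> space M. \<bar>weight_defect n (m n) (\<lambda>i. w n i \<omega>) - 0\<bar> > \<epsilon>}
          \<le> prob {\<omega> \<in> space M. weight_defect n (m n) (\<lambda>i. w n i \<omega>) > \<delta>}"
        by (intro finite_measure_mono sets_count_event[OF Wm determined_on_weight_defect])
          (auto simp: \<delta>_def)
      also have "\<dots> \<le> 16 / \<delta>\<^sup>2 * (1 / real (m n) + 5 / real n)"
        by (rule prob_weight_defect[OF M W[OF n] n mn \<delta> \<open>4 / real n \<le> \<delta>\<close>])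
      finally show ?case .
    qed
    have "(\<lambda>n. 16 / \<delta>\<^sup>2 * (1 / real (m n) + 5 / real n)) \<longlonglongrightarrow> 16 / \<delta>\<^sup>2 * (0 + 0)"
      by (intro tendsto_intros inv_n inv_m)
    then show "(\<lambda>n. 16 / \<delta>\<^sup>2 * (1 / real (m n) + 5 / real n)) \<longlonglongrightarrow> 0" by simp
  qed simp
qed

lemma tendsto_max_weight_ratio:
  assumes Pw: "prob_space Pw"
    and W: "\<And>n. n \<ge> 1 \<Longrightarrow> multinomial_distributed Pw n (m n) (\<lambda>_. 1 / real n) (w n)"
    and m: "filterlim m at_top sequentially"
  shows "tendsto_in_prob Pw (\<lambda>n \<omega>. max_weight_ratio n (m n) (\<lambda>i. w n i \<omega>)) 0"
  unfolding tendsto_in_prob_def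
proof (intro allI impI)
  fix \<epsilon> :: real assume "\<epsilon> > 0"
  interpret Pw: prob_space Pw by fact
  let ?D = "\<lambda>n. {\<omega> \<in> space Pw. \<bar>weight_defect n (m n) (\<lambda>i. w n i \<omega>) - 0\<bar> > \<epsilon>}"
  have D: "(\<lambda>n. Pw.prob (?D n)) \<longlonglongrightarrow> 0"
    using tendsto_in_probD[OF tendsto_weight_defect[OF Pw W m] \<open>\<epsilon> > 0\<close>] .
  have "\<forall>\<^sub>F n in sequentially. Pw.prob {\<omega> \<in> space Pw. \<bar>max_weight_ratio n (m n) (\<lambda>i. w n i \<omega>) - 0\<bar> > \<epsilon>} \<le> Pw.prob (?D n)"
    using eventually_ge_at_top[of 1]
  proof eventually_elim
    case (elim n)
    have Wm: "\<And>i. i \<in> {1..n} \<Longrightarrow> w n i \<in> measurable Pw (count_space UNIV)"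
      using W[OF elim] by (auto simp: multinomial_distributed_def)
    have nonneg: "0 \<le> max_weight_ratio n (m n) k" "max_weight_ratio n (m n) k \<le> weight_defect n (m n) k" for k
      using max_weight_ratio_nonneg[OF elim] by (simp_all add: weight_defect_def)
    then have "0 \<le> weight_defect n (m n) k" for k
      using order_trans by blast
    then have "?D n = {\<omega> \<in> space Pw. weight_defect n (m n) (\<lambda>i. w n i \<omega>) > \<epsilon>}" by simp
    also have "\<dots> \<in> sets Pw"
      by (rule sets_count_event[OF Wm determined_on_weight_defect])
    finally have "?D n \<in> sets Pw" .
    moreover have "{\<omega> \<in> space Pw. \<bar>max_weight_ratio n (m n) (\<lambda>i. w n i \<omega>) - 0\<bar> > \<epsilon>} \<subseteq> ?D n"
    proof
      fix \<omega> assume "\<omega> \<in> {\<omega> \<in> space Pw. \<bar>max_weight_ratio n (m n) (\<lambda>i. w n i \<omega>) - 0\<bar> > \<epsilon>}"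
      then show "\<omega> \<in> ?D n" using nonneg[of "\<lambda>i. w n i \<omega>"] by simp
    qed
    ultimately show ?case by (intro Pw.finite_measure_mono)
  qed
  then show "(\<lambda>n. Pw.prob {\<omega> \<in> space Pw. \<bar>max_weight_ratio n (m n) (\<lambda>i. w n i \<omega>) - 0\<bar> > \<epsilon>}) \<longlonglongrightarrow> 0"
    by (intro tendsto_sandwich[OF always_eventually _ tendsto_const D]) auto
qed

section \<open>Limit theorems for weighted sums of an i.i.d. sample\<close>

locale iid_sample = prob_space M for M :: "'a measure" +
  fixes X :: "'a \<Rightarrow> real" and Xs :: "nat \<Rightarrow> 'a \<Rightarrow> real"
  assumes X_measurable [measurable]: "X \<in> borel_measurable M"
    and indep: "indep_vars (\<lambda>_. borel) Xs {1..}"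
    and distr_Xs: "\<And>i. i \<ge> 1 \<Longrightarrow> distr M borel (Xs i) = distr M borel X"
begin

lemma Xs_measurable [measurable (raw)]: "i \<ge> 1 \<Longrightarrow> Xs i \<in> borel_measurable M"
  using indep by (auto simp: indep_vars_def)

lemma weighted_sum_measurable [measurable]:
  fixes f :: "real \<Rightarrow> real" and p :: "nat \<Rightarrow> real"
  assumes [measurable]: "f \<in> borel_measurable borel"
  shows "(\<lambda>x. \<Sum>i=1..n. p i * f (Xs i x)) \<in> borel_measurable M"
proof (intro borel_measurable_sum borel_measurable_times borel_measurable_const)
  show "(\<lambda>x. f (Xs i x)) \<in> borel_measurable M" if "i \<in> {1..n}" for i
    using measurable_compose[OF Xs_measurable assms, of i] that by simp
qed

lemma integral_Xs:
  fixes f :: "real \<Rightarrow> real"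
  assumes "i \<ge> 1" and [measurable]: "f \<in> borel_measurable borel"
  shows "expectation (\<lambda>x. f (Xs i x)) = expectation (\<lambda>x. f (X x))"
  using arg_cong[OF distr_Xs[OF assms(1)], of "\<lambda>\<mu>. integral\<^sup>L \<mu> f"] Xs_measurable[OF assms(1)]
  by (simp add: integral_distr)

lemma integrable_Xs:
  fixes f :: "real \<Rightarrow> real"
  assumes "i \<ge> 1" and [measurable]: "f \<in> borel_measurable borel" and "integrable M (\<lambda>x. f (X x))"
  shows "integrable M (\<lambda>x. f (Xs i x))"
  using assms(3) arg_cong[OF distr_Xs[OF assms(1)], of "\<lambda>\<mu>. integrable \<mu> f"] Xs_measurable[OF assms(1)]
  by (simp add: integrable_distr_eq)

lemma iid_sample_compose:
  assumes [measurable]: "f \<in> borel_measurable borel"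
  shows "iid_sample M (\<lambda>x. f (X x)) (\<lambda>i x. f (Xs i x))"
proof unfold_locales
  show "indep_vars (\<lambda>_. borel) (\<lambda>i x. f (Xs i x)) {1..}"
    using indep by (rule indep_vars_compose2) simp
  show "distr M borel (\<lambda>x. f (Xs i x)) = distr M borel (\<lambda>x. f (X x))" if "i \<ge> 1" for i
    using arg_cong[OF distr_Xs[OF that], of "\<lambda>\<mu>. distr \<mu> borel f"] Xs_measurable[OF that]
    by (simp add: distr_distr comp_def)
qed simp

text \<open>
  Independent variables with mean zero are orthogonal.
\<close>

lemma second_moment_weighted_sum:
  assumes X2: "integrable M (\<lambda>x. (X x)\<^sup>2)" and mean: "expectation X = 0"
  shows "integrable M (\<lambda>x. (\<Sum>i=1..n. p i * Xs i x)\<^sup>2)"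
    and "expectation (\<lambda>x. (\<Sum>i=1..n. p i * Xs i x)\<^sup>2) = (\<Sum>i=1..n. (p i)\<^sup>2) * expectation (\<lambda>x. (X x)\<^sup>2)"
proof -
  have X1: "integrable M X"
    using X2 by (rule square_integrable_imp_integrable[rotated]) simp
  have prod: "integrable M (\<lambda>x. Xs i x * Xs j x) \<and>
      expectation (\<lambda>x. Xs i x * Xs j x) = (if i = j then expectation (\<lambda>x. (X x)\<^sup>2) else 0)"
    if "i \<in> {1..n}" "j \<in> {1..n}" for i j
  proof (cases "i = j")
    case True
    then show ?thesis
      using that integral_Xs[of i "\<lambda>y. y\<^sup>2"] integrable_Xs[of i "\<lambda>y. y\<^sup>2"] X2
      by (simp add: power2_eq_square)
  next
    case False
    have ind: "indep_vars (\<lambda>_. borel) Xs {i, j}"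
      using indep by (rule indep_vars_subset) (use that in auto)
    have int: "integrable M (Xs l)" "expectation (Xs l) = 0" if "l \<in> {i, j}" for l
      using that \<open>i \<in> {1..n}\<close> \<open>j \<in> {1..n}\<close> integral_Xs[of l "\<lambda>y. y"] integrable_Xs[of l "\<lambda>y. y"] X1 mean by auto
    show ?thesis
      using indep_vars_lebesgue_integral[OF _ ind int(1)] indep_vars_integrable[OF _ ind int(1)] int(2) False
      by simp
  qed
  have sq: "(\<Sum>i=1..n. p i * Xs i x)\<^sup>2 = (\<Sum>i=1..n. \<Sum>j=1..n. (p i * p j) * (Xs i x * Xs j x))" for x
    by (simp add: power2_eq_square sum_product mult_ac)
  have int: "integrable M (\<lambda>x. (p i * p j) * (Xs i x * Xs j x))" if "i \<in> {1..n}" "j \<in> {1..n}" for i j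
    by (rule integrable_mult_right) (use prod[OF that] in simp)
  show "integrable M (\<lambda>x. (\<Sum>i=1..n. p i * Xs i x)\<^sup>2)"
    unfolding sq by (intro Bochner_Integration.integrable_sum int)
  have "expectation (\<lambda>x. (\<Sum>i=1..n. p i * Xs i x)\<^sup>2)
      = (\<Sum>i=1..n. expectation (\<lambda>x. \<Sum>j=1..n. (p i * p j) * (Xs i x * Xs j x)))"
    unfolding sq by (intro Bochner_Integration.integral_sum Bochner_Integration.integrable_sum int)
  also have "\<dots> = (\<Sum>i=1..n. \<Sum>j=1..n. expectation (\<lambda>x. (p i * p j) * (Xs i x * Xs j x)))"
    by (intro sum.cong refl Bochner_Integration.integral_sum int)
  also have "\<dots> = (\<Sum>i=1..n. \<Sum>j=1..n. (p i * p j) * expectation (\<lambda>x. Xs i x * Xs j x))"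
    by (simp only: integral_mult_right_zero)
  also have "\<dots> = (\<Sum>i=1..n. \<Sum>j=1..n. if i = j then (p i)\<^sup>2 * expectation (\<lambda>x. (X x)\<^sup>2) else 0)"
    using prod by (intro sum.cong refl) (auto simp: power2_eq_square)
  also have "\<dots> = (\<Sum>i=1..n. (p i)\<^sup>2) * expectation (\<lambda>x. (X x)\<^sup>2)"
    by (simp add: sum_distrib_right)
  finally show "expectation (\<lambda>x. (\<Sum>i=1..n. p i * Xs i x)\<^sup>2) = (\<Sum>i=1..n. (p i)\<^sup>2) * expectation (\<lambda>x. (X x)\<^sup>2)" .
qed

text \<open>
  The law is also applied to the squares of the data, for which only a first moment is available, so
  the variable is truncated at a level \<open>K\<close>: the centred bounded part has second moment at most
  \<open>(2 * K)\<^sup>2 * (\<Sum>i. (p i)\<^sup>2)\<close>, which vanishes in the limit, and the remainder is small in mean,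
  uniformly in the weights.
\<close>

lemma weighted_weak_law:
  assumes X1: "integrable M X"
    and p_nonneg: "\<And>j i. i \<in> {1..s j} \<Longrightarrow> 0 \<le> p j i"
    and p_sum: "\<And>j. (\<Sum>i=1..s j. p j i) = 1"
    and p_sq: "(\<lambda>j. \<Sum>i=1..s j. (p j i)\<^sup>2) \<longlonglongrightarrow> 0"
  shows "tendsto_in_prob M (\<lambda>j x. \<Sum>i=1..s j. p j i * Xs i x) (expectation X)"
proof (rule tendsto_in_probI)
  fix \<epsilon> \<eta> :: real assume "\<epsilon> > 0" "\<eta> > 0"
  define g where "g K y = (if \<bar>y\<bar> \<le> real K then y else 0)" for K :: nat and y :: real
  have g_measurable [measurable]: "g K \<in> borel_measurable borel" for K
    unfolding g_def by measurable
  have "(\<lambda>K. expectation (\<lambda>x. \<bar>X x - g K (X x)\<bar>)) \<longlonglongrightarrow> expectation (\<lambda>x. 0)"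
  proof (rule integral_dominated_convergence[where w="\<lambda>x. \<bar>X x\<bar>"])
    show "AE x in M. (\<lambda>K. \<bar>X x - g K (X x)\<bar>) \<longlonglongrightarrow> 0"
    proof (rule AE_I2)
      fix x
      have "\<forall>\<^sub>F K in sequentially. \<bar>X x\<bar> \<le> real K"
        using eventually_ge_at_top[of "nat \<lceil>\<bar>X x\<bar>\<rceil>"] by eventually_elim linarith
      then show "(\<lambda>K. \<bar>X x - g K (X x)\<bar>) \<longlonglongrightarrow> 0"
        by (intro tendsto_eventually, eventually_elim) (simp add: g_def)
    qed
  qed (use X1 in \<open>auto simp: g_def\<close>)
  \<comment> \<open>Markov's inequality at level \<open>\<epsilon> / 2\<close> is applied to a variable of mean \<open>2 * \<kappa>\<close>, where \<open>\<kappa>\<close> is the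
    mean of the part cut off; \<open>\<kappa> < \<epsilon> * \<eta> / 8\<close> makes the resulting bound less than \<open>\<eta> / 2\<close>.\<close>
  moreover have "\<epsilon> * \<eta> / 8 > 0" using \<open>\<epsilon> > 0\<close> \<open>\<eta> > 0\<close> by simp
  ultimately have "\<forall>\<^sub>F K in sequentially. expectation (\<lambda>x. \<bar>X x - g K (X x)\<bar>) < \<epsilon> * \<eta> / 8"
    by (intro order_tendstoD(2)) auto
  then obtain K where K: "expectation (\<lambda>x. \<bar>X x - g K (X x)\<bar>) < \<epsilon> * \<eta> / 8"
    by (auto simp: eventually_sequentially)
  define \<mu> where "\<mu> = expectation (\<lambda>x. g K (X x))"
  define A where "A y = g K y - \<mu>" for y
  define H where "H y = y - g K y" for y
  define \<kappa> where "\<kappa> = expectation (\<lambda>x. \<bar>H (X x)\<bar>)"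
  have [measurable]: "A \<in> borel_measurable borel" "H \<in> borel_measurable borel"
    unfolding A_def H_def by measurable
  have g_bounded: "\<bar>g K y\<bar> \<le> real K" for y by (simp add: g_def)
  have g_int: "integrable M (\<lambda>x. g K (X x))"
    by (rule integrable_const_bound[where B = "real K"]) (use g_bounded in auto)
  have H_int: "integrable M (\<lambda>x. H (X x))"
    unfolding H_def using X1 g_int by simp
  have \<mu>_bounded: "\<bar>\<mu>\<bar> \<le> real K"
    unfolding \<mu>_def
  proof (rule order_trans[OF integral_abs_bound])
    show "expectation (\<lambda>x. \<bar>g K (X x)\<bar>) \<le> real K"
      using g_int g_bounded by (intro integral_le_const) auto
  qed
  have A_bounded: "(A y)\<^sup>2 \<le> (2 * real K)\<^sup>2" for y
  proof -
    have "\<bar>A y\<bar> \<le> \<bar>2 * real K\<bar>"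
      unfolding A_def using g_bounded[of y] \<mu>_bounded by linarith
    then show ?thesis by (simp only: abs_le_square_iff)
  qed
  have A_sq: "integrable M (\<lambda>x. (A (X x))\<^sup>2)"
    by (rule integrable_const_bound[where B = "(2 * real K)\<^sup>2"])
      (simp_all only: real_norm_def abs_power2 A_bounded AE_I2, measurable)
  have A_mean: "expectation (\<lambda>x. A (X x)) = 0"
    unfolding A_def using g_int by (simp add: \<mu>_def prob_space)
  interpret A: iid_sample M "\<lambda>x. A (X x)" "\<lambda>i x. A (Xs i x)"
    by (rule iid_sample_compose) simp
  define \<nu> where "\<nu> = expectation (\<lambda>x. H (X x))"
  define S1 where "S1 j x = (\<Sum>i=1..s j. p j i * A (Xs i x))" for j x
  define S2 where "S2 j x = (\<Sum>i=1..s j. p j i * H (Xs i x)) - \<nu>" for j x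
  have [measurable]: "S1 j \<in> borel_measurable M" for j
    unfolding S1_def by (rule weighted_sum_measurable) simp
  have [measurable]: "S2 j \<in> borel_measurable M" for j
    unfolding S2_def by (intro borel_measurable_diff weighted_sum_measurable borel_measurable_const) simp
  have decomp: "(\<Sum>i=1..s j. p j i * Xs i x) - expectation X = S1 j x + S2 j x" for j x
  proof -
    have "expectation X = \<mu> + \<nu>"
      using X1 g_int by (simp add: \<mu>_def \<nu>_def H_def)
    moreover have "(\<Sum>i=1..s j. p j i * Xs i x) = S1 j x + (\<Sum>i=1..s j. p j i * H (Xs i x)) + \<mu> * (\<Sum>i=1..s j. p j i)"
      unfolding S1_def sum_distrib_left sum.distrib[symmetric]
      by (intro sum.cong) (auto simp: A_def H_def algebra_simps)
    ultimately show ?thesis unfolding p_sum S2_def by simp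
  qed
  have S1: "prob {x \<in> space M. \<epsilon> / 2 \<le> \<bar>S1 j x\<bar>} \<le> (\<Sum>i=1..s j. (p j i)\<^sup>2) * (2 * real K)\<^sup>2 / (\<epsilon> / 2)\<^sup>2" for j
  proof -
    have "(\<epsilon> / 2)\<^sup>2 \<le> y\<^sup>2 \<longleftrightarrow> \<epsilon> / 2 \<le> \<bar>y\<bar>" for y
      unfolding abs_le_square_iff[symmetric] using \<open>\<epsilon> > 0\<close> by simp
    then have "prob {x \<in> space M. \<epsilon> / 2 \<le> \<bar>S1 j x\<bar>} = prob {x \<in> space M. (\<epsilon> / 2)\<^sup>2 \<le> (S1 j x)\<^sup>2}"
      by (simp only:)
    also have "\<dots> \<le> expectation (\<lambda>x. (S1 j x)\<^sup>2) / (\<epsilon> / 2)\<^sup>2"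
      unfolding S1_def using \<open>\<epsilon> > 0\<close>
      by (intro integral_Markov_inequality_measure[where A="space M"]
          A.second_moment_weighted_sum(1)[OF A_sq A_mean] AE_I2 zero_le_power2) simp_all
    also have "\<dots> \<le> (\<Sum>i=1..s j. (p j i)\<^sup>2) * (2 * real K)\<^sup>2 / (\<epsilon> / 2)\<^sup>2"
      unfolding S1_def A.second_moment_weighted_sum(2)[OF A_sq A_mean] using A_sq
      by (intro divide_right_mono mult_left_mono integral_le_const sum_nonneg AE_I2 A_bounded zero_le_power2)
    finally show ?thesis .
  qed
  have S2: "prob {x \<in> space M. \<epsilon> / 2 \<le> \<bar>S2 j x\<bar>} \<le> \<eta> / 2" for j
  proof -
    have H_Xs: "integrable M (\<lambda>x. \<bar>H (Xs i x)\<bar>)" "expectation (\<lambda>x. \<bar>H (Xs i x)\<bar>) = \<kappa>" if "i \<in> {1..s j}" for i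
      using that integrable_Xs[of i "\<lambda>y. \<bar>H y\<bar>"] integral_Xs[of i "\<lambda>y. \<bar>H y\<bar>"] H_int by (auto simp: \<kappa>_def)
    have bound: "\<bar>S2 j x\<bar> \<le> (\<Sum>i=1..s j. p j i * \<bar>H (Xs i x)\<bar>) + \<kappa>" for x
    proof -
      have "\<bar>\<Sum>i=1..s j. p j i * H (Xs i x)\<bar> \<le> (\<Sum>i=1..s j. p j i * \<bar>H (Xs i x)\<bar>)"
        using p_nonneg by (intro order_trans[OF sum_abs] sum_mono) (auto simp: abs_mult)
      moreover have "\<bar>\<nu>\<bar> \<le> \<kappa>"
        unfolding \<kappa>_def \<nu>_def by (rule integral_abs_bound)
      ultimately show ?thesis unfolding S2_def by linarith
    qed
    define G where "G x = (\<Sum>i=1..s j. p j i * \<bar>H (Xs i x)\<bar>) + \<kappa>" for x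
    have sum_int: "integrable M (\<lambda>x. \<Sum>i=1..s j. p j i * \<bar>H (Xs i x)\<bar>)"
      by (intro Bochner_Integration.integrable_sum integrable_mult_right H_Xs)
    have int: "integrable M G"
      unfolding G_def using sum_int by (intro Bochner_Integration.integrable_add) simp_all
    have [measurable]: "G \<in> borel_measurable M"
      using int by (rule borel_measurable_integrable)
    have S2_le: "\<bar>S2 j x\<bar> \<le> G x" for x
      using bound[of x] by (simp only: G_def)
    have "prob {x \<in> space M. \<epsilon> / 2 \<le> \<bar>S2 j x\<bar>} \<le> prob {x \<in> space M. \<epsilon> / 2 \<le> G x}"
    proof (intro finite_measure_mono subsetI)
      fix x assume "x \<in> {x \<in> space M. \<epsilon> / 2 \<le> \<bar>S2 j x\<bar>}"
      then show "x \<in> {x \<in> space M. \<epsilon> / 2 \<le> G x}" using S2_le[of x] by simp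
    qed measurable
    also have "\<dots> \<le> expectation G / (\<epsilon> / 2)"
      using int \<open>\<epsilon> > 0\<close> order_trans[OF abs_ge_zero S2_le]
      by (intro integral_Markov_inequality_measure[where A="space M"] AE_I2) simp_all
    also have "expectation G = expectation (\<lambda>x. \<Sum>i=1..s j. p j i * \<bar>H (Xs i x)\<bar>) + expectation (\<lambda>x. \<kappa>)"
      unfolding G_def using sum_int by (rule Bochner_Integration.integral_add) simp
    also have "expectation (\<lambda>x. \<Sum>i=1..s j. p j i * \<bar>H (Xs i x)\<bar>)
        = (\<Sum>i=1..s j. expectation (\<lambda>x. p j i * \<bar>H (Xs i x)\<bar>))"
      by (intro Bochner_Integration.integral_sum integrable_mult_right H_Xs)
    also have "\<dots> = (\<Sum>i=1..s j. p j i * \<kappa>)"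
      using H_Xs(2) by (intro sum.cong refl) simp
    also have "\<dots> = \<kappa>"
      unfolding sum_distrib_right[symmetric] p_sum by simp
    also have "\<kappa> + expectation (\<lambda>x. \<kappa>) = 2 * \<kappa>"
      by (simp add: prob_space)
    also have "2 * \<kappa> / (\<epsilon> / 2) \<le> \<eta> / 2"
      using K \<open>\<epsilon> > 0\<close> by (simp add: \<kappa>_def H_def field_simps)
    finally show ?thesis .
  qed
  have "(\<lambda>j. (\<Sum>i=1..s j. (p j i)\<^sup>2) * (2 * real K)\<^sup>2 / (\<epsilon> / 2)\<^sup>2) \<longlonglongrightarrow> 0 * (2 * real K)\<^sup>2 / (\<epsilon> / 2)\<^sup>2"
    using \<open>\<epsilon> > 0\<close> by (intro tendsto_intros p_sq) auto
  then have lim: "(\<lambda>j. (\<Sum>i=1..s j. (p j i)\<^sup>2) * (2 * real K)\<^sup>2 / (\<epsilon> / 2)\<^sup>2) \<longlonglongrightarrow> 0"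
    by (simp only: mult_zero_left div_0)
  have "0 < \<eta> / 2" using \<open>\<eta> > 0\<close> by simp
  from order_tendstoD(2)[OF lim this]
  show "\<forall>\<^sub>F j in sequentially. prob {x \<in> space M. \<bar>(\<Sum>i=1..s j. p j i * Xs i x) - expectation X\<bar> > \<epsilon>} < \<eta>"
  proof eventually_elim
    case (elim j)
    have "prob {x \<in> space M. \<bar>(\<Sum>i=1..s j. p j i * Xs i x) - expectation X\<bar> > \<epsilon>}
      \<le> prob ({x \<in> space M. \<epsilon> / 2 \<le> \<bar>S1 j x\<bar>} \<union> {x \<in> space M. \<epsilon> / 2 \<le> \<bar>S2 j x\<bar>})"
      unfolding decomp
    proof (intro finite_measure_mono subsetI)
      fix x assume "x \<in> {x \<in> space M. \<bar>S1 j x + S2 j x\<bar> > \<epsilon>}"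
      then have "x \<in> space M" "\<epsilon> < \<bar>S1 j x\<bar> + \<bar>S2 j x\<bar>"
        using abs_triangle_ineq[of "S1 j x" "S2 j x"] by simp_all
      moreover from this have "\<epsilon> / 2 \<le> \<bar>S1 j x\<bar> \<or> \<epsilon> / 2 \<le> \<bar>S2 j x\<bar>"
        by linarith
      ultimately show "x \<in> {x \<in> space M. \<epsilon> / 2 \<le> \<bar>S1 j x\<bar>} \<union> {x \<in> space M. \<epsilon> / 2 \<le> \<bar>S2 j x\<bar>}"
        by blast
    qed measurable
    also have "\<dots> \<le> prob {x \<in> space M. \<epsilon> / 2 \<le> \<bar>S1 j x\<bar>} + prob {x \<in> space M. \<epsilon> / 2 \<le> \<bar>S2 j x\<bar>}"
      by (intro measure_Un_le) auto
    also have "\<dots> < \<eta>" using S1[of j] S2[of j] elim by linarith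
    finally show ?case .
  qed
qed

text \<open>
  The characteristic function of the sum is the product of the \<open>\<phi> (a i * t)\<close>, and
  \<open>exp (- t\<^sup>2 / 2)\<close> is the product of the \<open>exp (- (a i * t)\<^sup>2 / 2)\<close> because the \<open>(a i)\<^sup>2\<close> sum to \<open>1\<close>. All
  factors have modulus at most \<open>1\<close>, so the products differ by at most the sum of the differences of
  the factors. By the second-order expansion of \<open>\<phi>\<close> each of these is at most \<open>(a i)\<^sup>2 * err\<close>, where
  \<open>err\<close> depends only on the bound \<open>b\<close> for the coefficients and tends to \<open>0\<close> with it.
\<close>

lemma weighted_clt:
  assumes X2: "integrable M (\<lambda>x. (X x)\<^sup>2)" and mean: "expectation X = 0"
    and var: "expectation (\<lambda>x. (X x)\<^sup>2) = 1"
    and a_sq: "\<And>j. (\<Sum>i=1..s j. (a j i)\<^sup>2) = 1"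
    and a_le: "\<And>j i. i \<in> {1..s j} \<Longrightarrow> \<bar>a j i\<bar> \<le> b j" and b: "b \<longlonglongrightarrow> 0"
  shows "weak_conv_m (\<lambda>j. distr M borel (\<lambda>x. \<Sum>i=1..s j. a j i * Xs i x)) std_normal_distribution"
proof (rule levy_continuity)
  show "real_distribution (distr M borel (\<lambda>x. \<Sum>i=1..s j. a j i * Xs i x))" for j
    by (rule real_distribution_distr) simp
  show "real_distribution std_normal_distribution"
    by (rule real_dist_normal_dist)
  have X1: "integrable M X"
    using X2 by (rule square_integrable_imp_integrable[rotated]) simp
  interpret X: real_distribution "distr M borel X"
    by (rule real_distribution_distr) simp
  fix t :: real
  define \<phi> where "\<phi> u = char (distr M borel X) u" for u
  define h where "h r = expectation (\<lambda>x. min (6 * (X x)\<^sup>2) (\<bar>r\<bar> * \<bar>X x\<bar> ^ 3))" for r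
  define err where "err j = t\<^sup>2 / 6 * h (b j * t) + (b j)\<^sup>2 * t ^ 4 / 8" for j
  have h_int: "integrable M (\<lambda>x. min (6 * (X x)\<^sup>2) (\<bar>r\<bar> * \<bar>X x\<bar> ^ 3))" for r
    by (rule Bochner_Integration.integrable_bound[where f="\<lambda>x. 6 * (X x)\<^sup>2"]) (use X2 in auto)
  have h_mono: "h q \<le> h r" if "\<bar>q\<bar> \<le> \<bar>r\<bar>" for q r
    unfolding h_def using that
    by (intro integral_mono h_int min.mono mult_right_mono) auto
  have \<phi>_approx: "cmod (\<phi> u - of_real (1 - u\<^sup>2 / 2)) \<le> u\<^sup>2 / 6 * h u" for u
    unfolding \<phi>_def h_def
    using char_approx3'[of X 1 "distr M borel X" u] X1 X2 mean var by simp
  have char_sum: "char (distr M borel (\<lambda>x. \<Sum>i=1..s j. a j i * Xs i x)) t = (\<Prod>i=1..s j. \<phi> (a j i * t))" for j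
  proof -
    have "indep_vars (\<lambda>_. borel) (\<lambda>i x. a j i * Xs i x) {1..s j}"
      by (rule indep_vars_compose2[OF indep_vars_subset[OF indep]]) auto
    then have "char (distr M borel (\<lambda>x. \<Sum>i=1..s j. a j i * Xs i x)) t
        = (\<Prod>i=1..s j. char (distr M borel (\<lambda>x. a j i * Xs i x)) t)"
      by (rule char_distr_sum)
    also have "char (distr M borel (\<lambda>x. a j i * Xs i x)) t = \<phi> (a j i * t)" if "i \<in> {1..s j}" for i
    proof -
      have "\<phi> (a j i * t) = char (distr M borel (Xs i)) (a j i * t)"
        using that by (simp add: \<phi>_def distr_Xs)
      then show ?thesis using that
        by (simp add: char_def integral_distr mult_ac)
    qed
    then have "(\<Prod>i=1..s j. char (distr M borel (\<lambda>x. a j i * Xs i x)) t) = (\<Prod>i=1..s j. \<phi> (a j i * t))"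
      by (intro prod.cong) auto
    finally show ?thesis .
  qed
  have term_bound: "cmod (\<phi> (a j i * t) - of_real (exp (- (a j i * t)\<^sup>2 / 2))) \<le> (a j i)\<^sup>2 * err j"
    if i: "i \<in> {1..s j}" for i j
  proof -
    define u where "u = a j i * t"
    have u: "\<bar>u\<bar> \<le> \<bar>b j * t\<bar>"
      using a_le[OF i] unfolding u_def abs_mult by (intro mult_right_mono) auto
    have a2: "(a j i)\<^sup>2 \<le> (b j)\<^sup>2"
      using a_le[OF i] by (simp add: abs_le_square_iff[symmetric])
    have "cmod (\<phi> u - of_real (exp (- u\<^sup>2 / 2)))
      \<le> cmod (\<phi> u - of_real (1 - u\<^sup>2 / 2)) + cmod (of_real (1 - u\<^sup>2 / 2) - of_real (exp (- u\<^sup>2 / 2)))"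
      by (rule order_trans[OF _ norm_triangle_ineq]) simp
    also have "\<dots> \<le> u\<^sup>2 / 6 * h (b j * t) + (u\<^sup>2 / 2)\<^sup>2 / 2"
    proof (rule add_mono)
      show "cmod (\<phi> u - of_real (1 - u\<^sup>2 / 2)) \<le> u\<^sup>2 / 6 * h (b j * t)"
        using h_mono[OF u] by (intro order_trans[OF \<phi>_approx] mult_left_mono) auto
      show "cmod (of_real (1 - u\<^sup>2 / 2) - of_real (exp (- u\<^sup>2 / 2))) \<le> (u\<^sup>2 / 2)\<^sup>2 / 2"
        using exp_minus_approx[of "u\<^sup>2 / 2"] unfolding of_real_diff[symmetric] norm_of_real
        by (simp add: abs_minus_commute)
    qed
    also have "(u\<^sup>2 / 2)\<^sup>2 / 2 = (a j i)\<^sup>2 * ((a j i)\<^sup>2 * t ^ 4 / 8)"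
      by (simp add: u_def power_mult_distrib power_divide power2_eq_square power4_eq_xxxx)
    also have "\<dots> \<le> (a j i)\<^sup>2 * ((b j)\<^sup>2 * t ^ 4 / 8)"
      using a2 by (intro mult_left_mono divide_right_mono mult_right_mono) auto
    finally show ?thesis
      by (simp add: u_def err_def power_mult_distrib algebra_simps)
  qed
  have bound: "cmod (char (distr M borel (\<lambda>x. \<Sum>i=1..s j. a j i * Xs i x)) t - of_real (exp (- t\<^sup>2 / 2))) \<le> err j" for j
  proof -
    have "exp (- t\<^sup>2 / 2) = (\<Prod>i=1..s j. exp (- (a j i * t)\<^sup>2 / 2))"
    proof -
      have "- t\<^sup>2 / 2 = (\<Sum>i=1..s j. (a j i)\<^sup>2) * (- t\<^sup>2 / 2)"
        unfolding a_sq by simp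
      also have "\<dots> = (\<Sum>i=1..s j. - (a j i * t)\<^sup>2 / 2)"
        unfolding sum_distrib_right by (intro sum.cong refl) (simp add: power_mult_distrib)
      finally show ?thesis by (simp only: exp_sum[OF finite_atLeastAtMost])
    qed
    then have "cmod (char (distr M borel (\<lambda>x. \<Sum>i=1..s j. a j i * Xs i x)) t - of_real (exp (- t\<^sup>2 / 2)))
      = cmod ((\<Prod>i=1..s j. \<phi> (a j i * t)) - (\<Prod>i=1..s j. of_real (exp (- (a j i * t)\<^sup>2 / 2))))"
      by (simp only: char_sum of_real_prod)
    also have "\<dots> \<le> (\<Sum>i=1..s j. cmod (\<phi> (a j i * t) - of_real (exp (- (a j i * t)\<^sup>2 / 2))))"
      by (rule norm_prod_diff) (simp_all add: \<phi>_def X.cmod_char_le_1)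
    also have "\<dots> \<le> (\<Sum>i=1..s j. (a j i)\<^sup>2 * err j)"
      by (intro sum_mono term_bound)
    also have "\<dots> = err j" using a_sq[of j] by (simp flip: sum_distrib_right)
    finally show ?thesis .
  qed
  have "(\<lambda>j. h (b j * t)) \<longlonglongrightarrow> expectation (\<lambda>x. 0)"
    unfolding h_def
  proof (rule integral_dominated_convergence[where w="\<lambda>x. 6 * (X x)\<^sup>2"])
    show "AE x in M. (\<lambda>j. min (6 * (X x)\<^sup>2) (\<bar>b j * t\<bar> * \<bar>X x\<bar> ^ 3)) \<longlonglongrightarrow> 0"
    proof (rule AE_I2)
      fix x
      have "(\<lambda>j. min (6 * (X x)\<^sup>2) (\<bar>b j * t\<bar> * \<bar>X x\<bar> ^ 3)) \<longlonglongrightarrow> min (6 * (X x)\<^sup>2) (\<bar>0 * t\<bar> * \<bar>X x\<bar> ^ 3)"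
        by (intro tendsto_intros b)
      then show "(\<lambda>j. min (6 * (X x)\<^sup>2) (\<bar>b j * t\<bar> * \<bar>X x\<bar> ^ 3)) \<longlonglongrightarrow> 0" by simp
    qed
  qed (use X2 in auto)
  then have "err \<longlonglongrightarrow> t\<^sup>2 / 6 * 0 + 0\<^sup>2 * t ^ 4 / 8"
    unfolding err_def by (intro tendsto_intros b) auto
  then have "(\<lambda>j. char (distr M borel (\<lambda>x. \<Sum>i=1..s j. a j i * Xs i x)) t - of_real (exp (- t\<^sup>2 / 2))) \<longlonglongrightarrow> 0"
    by (intro Lim_null_comparison[OF always_eventually[OF allI[OF bound]]]) simp
  then show "(\<lambda>j. char (distr M borel (\<lambda>x. \<Sum>i=1..s j. a j i * Xs i x)) t) \<longlonglongrightarrow> char std_normal_distribution t"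
    unfolding char_std_normal_distribution by (simp add: LIM_zero_iff)
qed

end

section \<open>Deterministic counts with well-behaved weights\<close>

text \<open>
  Deterministic counts that behave as the random weights do with high probability: \<open>s\<close> are the
  sample sizes and \<open>d\<close> the numbers of draws. The sizes form a sequence of their own so that
  subsequences of the original problem are included. The bound \<open>1 / 2\<close> keeps
  \<^const>\<open>weight_norm\<close> positive for every index.
\<close>

definition balanced_counts :: "(nat \<Rightarrow> nat) \<Rightarrow> (nat \<Rightarrow> nat) \<Rightarrow> (nat \<Rightarrow> nat \<Rightarrow> nat) \<Rightarrow> bool" where
  "balanced_counts s d k \<longleftrightarrow>
     (\<forall>j. s j \<ge> 1 \<and> d j \<ge> 1 \<and> (\<Sum>i=1..s j. k j i) = d j \<and> weight_defect (s j) (d j) (k j) \<le> 1 / 2) \<and>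
     filterlim s at_top sequentially \<and> filterlim d at_top sequentially \<and>
     (\<lambda>j. weight_defect (s j) (d j) (k j)) \<longlonglongrightarrow> 0"

lemma sum_draw_fraction:
  assumes "N \<ge> 1" "(\<Sum>i=1..n. k i) = N"
  shows "(\<Sum>i=1..n. real (k i) / real N) = 1"
  using assms(1) unfolding sum_divide_distrib[symmetric] of_nat_sum[symmetric] assms(2) by simp

lemma sum_centred_weight:
  assumes "n \<ge> 1" "N \<ge> 1" "(\<Sum>i=1..n. k i) = N"
  shows "(\<Sum>i=1..n. centred_weight n N k i) = 0"
  using assms(1) unfolding centred_weight_def sum_subtractf sum_draw_fraction[OF assms(2,3)]
  by simp

text \<open>
  Expand \<open>k i / N = centred_weight i + 1 / n\<close>; the mixed terms cancel because the centred weights sum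
  to \<open>0\<close>.
\<close>

lemma sum_draw_fraction_sq:
  assumes "n \<ge> 1" "N \<ge> 1" "(\<Sum>i=1..n. k i) = N"
  shows "(\<Sum>i=1..n. (real (k i) / real N)\<^sup>2) = (weight_norm n N k)\<^sup>2 + 1 / real n"
proof -
  have "(\<Sum>i=1..n. (real (k i) / real N)\<^sup>2)
      = (\<Sum>i=1..n. (centred_weight n N k i)\<^sup>2 + 2 / real n * centred_weight n N k i + (1 / real n)\<^sup>2)"
  proof (intro sum.cong refl)
    fix i
    have "real (k i) / real N = centred_weight n N k i + 1 / real n"
      by (simp add: centred_weight_def)
    then show "(real (k i) / real N)\<^sup>2
      = (centred_weight n N k i)\<^sup>2 + 2 / real n * centred_weight n N k i + (1 / real n)\<^sup>2"
      by (simp only: power2_sum) simp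
  qed
  also have "\<dots> = (\<Sum>i=1..n. (centred_weight n N k i)\<^sup>2) + 2 / real n * 0 + real n * (1 / real n)\<^sup>2"
    unfolding sum.distrib sum_distrib_left[symmetric] sum_centred_weight[OF assms] by simp
  also have "real n * (1 / real n)\<^sup>2 = 1 / real n"
    using assms(1) by (simp add: power2_eq_square)
  finally show ?thesis
    by (simp add: weight_norm_def sum_nonneg)
qed

lemma weighted_variance_eq:
  fixes p x :: "nat \<Rightarrow> real"
  assumes "(\<Sum>i=1..n. p i) = 1"
  shows "(\<Sum>i=1..n. p i * (x i - (\<Sum>i=1..n. p i * x i))\<^sup>2)
       = (\<Sum>i=1..n. p i * (x i)\<^sup>2) - (\<Sum>i=1..n. p i * x i)\<^sup>2"
proof -
  define c where "c = (\<Sum>i=1..n. p i * x i)"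
  have "(\<Sum>i=1..n. p i * (x i - c)\<^sup>2) = (\<Sum>i=1..n. p i * (x i)\<^sup>2 + (- 2 * c) * (p i * x i) + c\<^sup>2 * p i)"
    by (intro sum.cong refl) (simp add: power2_diff algebra_simps)
  also have "\<dots> = (\<Sum>i=1..n. p i * (x i)\<^sup>2) + (- 2 * c) * c + c\<^sup>2 * 1"
    unfolding sum.distrib sum_distrib_left[symmetric] c_def[symmetric] assms ..
  finally show ?thesis by (simp add: c_def power2_eq_square)
qed

text \<open>
  Both standard deviations are those of the data under a probability vector, \<open>1 / n\<close> here and
  \<open>k i / N\<close> for the bootstrap, which reduces them to weighted averages of the data and their squares.
\<close>

lemma sample_sd_eq:
  assumes "n \<ge> 1"
  shows "sample_sd n x = sqrt ((\<Sum>i=1..n. 1 / real n * (x i)\<^sup>2) - (\<Sum>i=1..n. 1 / real n * x i)\<^sup>2)"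
proof -
  have "(\<Sum>i=1..n. 1 / real n) = 1" using assms by simp
  from weighted_variance_eq[OF this, of x] show ?thesis
    unfolding sample_sd_def sample_mean_def sum_distrib_left by simp
qed

lemma boot_sd_eq:
  assumes "N \<ge> 1" "(\<Sum>i=1..n. k i) = N"
  shows "boot_sd n N k x = sqrt ((\<Sum>i=1..n. real (k i) / real N * (x i)\<^sup>2)
      - (\<Sum>i=1..n. real (k i) / real N * x i)\<^sup>2)"
  using weighted_variance_eq[OF sum_draw_fraction[OF assms], of x]
  unfolding boot_sd_def boot_mean_def sum_distrib_left by simp

lemma balanced_weight_norm:
  assumes "balanced_counts s d k"
  shows "weight_norm (s j) (d j) (k j) > 0"
    and "(\<lambda>j. real (d j) * (weight_norm (s j) (d j) (k j))\<^sup>2) \<longlonglongrightarrow> 1"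
    and "(\<lambda>j. (weight_norm (s j) (d j) (k j))\<^sup>2) \<longlonglongrightarrow> 0"
proof -
  have norm_sq: "(weight_norm n N k)\<^sup>2 = (\<Sum>i=1..n. (centred_weight n N k i)\<^sup>2)" for n N k
    by (simp add: weight_norm_def sum_nonneg)
  have le: "\<bar>real (d j) * (weight_norm (s j) (d j) (k j))\<^sup>2 - 1\<bar> \<le> weight_defect (s j) (d j) (k j)" for j
    using assms max_weight_ratio_nonneg[of "s j" "d j" "k j"]
    by (simp add: balanced_counts_def weight_defect_def norm_sq)
  have "weight_defect (s j) (d j) (k j) \<le> 1 / 2" using assms by (simp add: balanced_counts_def)
  with le[of j] have "weight_norm (s j) (d j) (k j) \<noteq> 0" by auto
  moreover have "weight_norm (s j) (d j) (k j) \<ge> 0" by (simp add: weight_norm_def sum_nonneg)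
  ultimately show "weight_norm (s j) (d j) (k j) > 0" by simp
  have "(\<lambda>j. real (d j) * (weight_norm (s j) (d j) (k j))\<^sup>2 - 1) \<longlonglongrightarrow> 0"
    by (rule Lim_null_comparison[where g="\<lambda>j. weight_defect (s j) (d j) (k j)"])
      (use le assms in \<open>auto simp: balanced_counts_def\<close>)
  then show lim: "(\<lambda>j. real (d j) * (weight_norm (s j) (d j) (k j))\<^sup>2) \<longlonglongrightarrow> 1"
    by (simp add: LIM_zero_iff)
  have "(\<lambda>j. 1 / real (d j)) \<longlonglongrightarrow> 0"
    using assms filterlim_compose[OF lim_const_over_n, of d sequentially 1] by (simp add: balanced_counts_def)
  from tendsto_mult[OF this lim]
  have "(\<lambda>j. 1 / real (d j) * (real (d j) * (weight_norm (s j) (d j) (k j))\<^sup>2)) \<longlonglongrightarrow> 0" by simp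
  moreover have "1 / real (d j) * (real (d j) * (weight_norm (s j) (d j) (k j))\<^sup>2) = (weight_norm (s j) (d j) (k j))\<^sup>2" for j
  proof -
    have "d j \<ge> 1" using assms by (simp add: balanced_counts_def)
    then show ?thesis by simp
  qed
  ultimately show "(\<lambda>j. (weight_norm (s j) (d j) (k j))\<^sup>2) \<longlonglongrightarrow> 0" by simp
qed

lemma normalised_weight:
  assumes "weight_norm n N k > 0"
  shows "(\<Sum>i=1..n. (centred_weight n N k i / weight_norm n N k)\<^sup>2) = 1"
    and "i \<in> {1..n} \<Longrightarrow> \<bar>centred_weight n N k i / weight_norm n N k\<bar> \<le> sqrt (max_weight_ratio n N k)"
proof -
  have norm_sq: "(weight_norm n N k)\<^sup>2 = (\<Sum>i=1..n. (centred_weight n N k i)\<^sup>2)"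
    by (simp add: weight_norm_def sum_nonneg)
  show "(\<Sum>i=1..n. (centred_weight n N k i / weight_norm n N k)\<^sup>2) = 1"
    unfolding power_divide sum_divide_distrib[symmetric] norm_sq[symmetric] using assms by simp
  assume "i \<in> {1..n}"
  then have "(centred_weight n N k i)\<^sup>2 \<le> (MAX i\<in>{1..n}. (centred_weight n N k i)\<^sup>2)"
    by (intro Max_ge) auto
  then have "(centred_weight n N k i / weight_norm n N k)\<^sup>2 \<le> max_weight_ratio n N k"
    unfolding max_weight_ratio_def norm_sq[symmetric] power_divide by (rule divide_right_mono) simp
  then show "\<bar>centred_weight n N k i / weight_norm n N k\<bar> \<le> sqrt (max_weight_ratio n N k)"
    using real_sqrt_le_mono by fastforce
qed

lemma balanced_max_weight_ratio:
  assumes "balanced_counts s d k"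
  shows "(\<lambda>j. max_weight_ratio (s j) (d j) (k j)) \<longlonglongrightarrow> 0"
proof (rule Lim_null_comparison[where g="\<lambda>j. weight_defect (s j) (d j) (k j)"])
  have "\<bar>max_weight_ratio (s j) (d j) (k j)\<bar> \<le> weight_defect (s j) (d j) (k j)" for j
    using assms max_weight_ratio_nonneg[of "s j" "d j" "k j"]
    by (simp add: balanced_counts_def weight_defect_def)
  then show "\<forall>\<^sub>F j in sequentially. norm (max_weight_ratio (s j) (d j) (k j)) \<le> weight_defect (s j) (d j) (k j)"
    by simp
  show "(\<lambda>j. weight_defect (s j) (d j) (k j)) \<longlonglongrightarrow> 0"
    using assms by (simp add: balanced_counts_def)
qed

section \<open>Limits of the bootstrap statistics for fixed counts\<close>

locale square_integrable_sample = iid_sample +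
  assumes X_sq: "integrable M (\<lambda>x. (X x)\<^sup>2)"
    and variance_pos: "variance X > 0"
begin

lemma X_int: "integrable M X"
  using X_sq by (rule square_integrable_imp_integrable[rotated]) simp

definition "\<sigma> = sqrt (variance X)"

lemma sigma_pos: "\<sigma> > 0"
  using variance_pos by (simp add: \<sigma>_def)

lemma weighted_sd_tendsto:
  assumes p_nonneg: "\<And>j i. i \<in> {1..s j} \<Longrightarrow> 0 \<le> p j i"
    and p_sum: "\<And>j. (\<Sum>i=1..s j. p j i) = 1"
    and p_sq: "(\<lambda>j. \<Sum>i=1..s j. (p j i)\<^sup>2) \<longlonglongrightarrow> 0"
  shows "tendsto_in_prob M (\<lambda>j x. sqrt ((\<Sum>i=1..s j. p j i * (Xs i x)\<^sup>2) - (\<Sum>i=1..s j. p j i * Xs i x)\<^sup>2)) \<sigma>"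
proof -
  interpret sq: iid_sample M "\<lambda>x. (X x)\<^sup>2" "\<lambda>i x. (Xs i x)\<^sup>2"
    by (rule iid_sample_compose) simp
  have "tendsto_in_prob M (\<lambda>j x. sqrt ((\<Sum>i=1..s j. p j i * (Xs i x)\<^sup>2) - (\<Sum>i=1..s j. p j i * Xs i x)\<^sup>2))
      (sqrt (expectation (\<lambda>x. (X x)\<^sup>2) - (expectation X)\<^sup>2))"
  proof (rule tendsto_in_prob_isCont2[where f="\<lambda>u v. sqrt (u - v\<^sup>2)"])
    show "(\<lambda>x. \<Sum>i=1..s j. p j i * (Xs i x)\<^sup>2) \<in> borel_measurable M" for j
      using weighted_sum_measurable[of "\<lambda>y. y\<^sup>2"] by simp
    show "(\<lambda>x. \<Sum>i=1..s j. p j i * Xs i x) \<in> borel_measurable M" for j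
      using weighted_sum_measurable[of "\<lambda>y. y"] by simp
    show "tendsto_in_prob M (\<lambda>j x. \<Sum>i=1..s j. p j i * (Xs i x)\<^sup>2) (expectation (\<lambda>x. (X x)\<^sup>2))"
      by (rule sq.weighted_weak_law[OF X_sq p_nonneg p_sum p_sq])
    show "tendsto_in_prob M (\<lambda>j x. \<Sum>i=1..s j. p j i * Xs i x) (expectation X)"
      by (rule weighted_weak_law[OF X_int p_nonneg p_sum p_sq])
  qed (intro continuous_intros)
  then show ?thesis
    using variance_eq[OF X_int X_sq] by (simp add: \<sigma>_def)
qed

lemma sum_measurable:
  assumes "\<And>i. i \<ge> 1 \<Longrightarrow> (\<lambda>x. f i x :: real) \<in> borel_measurable M"
  shows "(\<lambda>x. \<Sum>i=1..n. f i x) \<in> borel_measurable M"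
  using assms by (intro borel_measurable_sum) simp

lemma sample_sd_measurable [measurable]: "(\<lambda>x. sample_sd n (\<lambda>i. Xs i x)) \<in> borel_measurable M"
  unfolding sample_sd_def sample_mean_def
  by (intro measurable_compose[OF _ borel_measurable_sqrt] borel_measurable_times borel_measurable_const sum_measurable
      borel_measurable_power borel_measurable_diff Xs_measurable)

lemma boot_sd_measurable [measurable]: "(\<lambda>x. boot_sd n N k (\<lambda>i. Xs i x)) \<in> borel_measurable M"
  unfolding boot_sd_def boot_mean_def
  by (intro measurable_compose[OF _ borel_measurable_sqrt] borel_measurable_times borel_measurable_const sum_measurable
      borel_measurable_power borel_measurable_diff Xs_measurable)

lemma sample_sd_tendsto:
  assumes "balanced_counts s d k"
  shows "tendsto_in_prob M (\<lambda>j x. sample_sd (s j) (\<lambda>i. Xs i x)) \<sigma>"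
proof -
  have s: "s j \<ge> 1" for j
    using assms by (simp add: balanced_counts_def)
  have "filterlim s at_top sequentially"
    using assms by (simp add: balanced_counts_def)
  from filterlim_compose[OF lim_const_over_n this, of 1]
  have "(\<lambda>j. 1 / real (s j)) \<longlonglongrightarrow> 0" .
  moreover have "(\<Sum>i=1..s j. (1 / real (s j))\<^sup>2) = 1 / real (s j)" for j
    using s[of j] by (simp add: power2_eq_square)
  moreover have "(\<Sum>i=1..s j. 1 / real (s j)) = 1" for j
    using s[of j] by simp
  ultimately show ?thesis
    unfolding sample_sd_eq[OF s] by (intro weighted_sd_tendsto) simp_all
qed

lemma boot_sd_tendsto:
  assumes k: "balanced_counts s d k"
  shows "tendsto_in_prob M (\<lambda>j x. boot_sd (s j) (d j) (k j) (\<lambda>i. Xs i x)) \<sigma>"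
proof -
  have s: "s j \<ge> 1" and d: "d j \<ge> 1" and sum: "(\<Sum>i=1..s j. k j i) = d j"
    for j
    using k by (auto simp: balanced_counts_def)
  have "filterlim s at_top sequentially"
    using k by (simp add: balanced_counts_def)
  from filterlim_compose[OF lim_const_over_n this, of 1]
  have "(\<lambda>j. 1 / real (s j)) \<longlonglongrightarrow> 0" .
  from tendsto_add[OF balanced_weight_norm(3)[OF k] this]
  have "(\<lambda>j. \<Sum>i=1..s j. (real (k j i) / real (d j))\<^sup>2) \<longlonglongrightarrow> 0"
    unfolding sum_draw_fraction_sq[OF s d sum] by simp
  moreover have "(\<Sum>i=1..s j. real (k j i) / real (d j)) = 1" for j
    by (rule sum_draw_fraction[OF d sum])
  ultimately show ?thesis
    unfolding boot_sd_eq[OF d sum] by (intro weighted_sd_tendsto) simp_all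
qed

text \<open>
  The common form of both statistics, with \<open>\<tau>\<close> standing for any consistent estimator of the
  standard deviation. Since the centred weights sum to \<open>0\<close>, the data can be replaced by their
  standardised values at the cost of the factor \<open>\<sigma>\<close>.
\<close>

lemma studentised_clt:
  assumes k: "balanced_counts s d k"
    and \<tau>_measurable: "\<And>j. \<tau> j \<in> borel_measurable M" and \<tau>: "tendsto_in_prob M \<tau> \<sigma>"
  shows "(\<lambda>j. prob {x \<in> space M. (\<Sum>i=1..s j. centred_weight (s j) (d j) (k j) i * Xs i x) /
      (\<tau> j x * weight_norm (s j) (d j) (k j)) \<le> t}) \<longlonglongrightarrow> cdf std_normal_distribution t"
proof -
  define a where "a j i = centred_weight (s j) (d j) (k j) i / weight_norm (s j) (d j) (k j)" for j i
  define \<mu> where "\<mu> = expectation X"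
  interpret Z: iid_sample M "\<lambda>x. (X x - \<mu>) / \<sigma>" "\<lambda>i x. (Xs i x - \<mu>) / \<sigma>"
    by (rule iid_sample_compose[of "\<lambda>y. (y - \<mu>) / \<sigma>"]) simp
  define Y where "Y j x = (\<Sum>i=1..s j. a j i * ((Xs i x - \<mu>) / \<sigma>))" for j x
  have Y_measurable: "Y j \<in> borel_measurable M" for j
    unfolding Y_def using Z.weighted_sum_measurable[of "\<lambda>y. y"] by simp
  have "weak_conv_m (\<lambda>j. distr M borel (Y j)) std_normal_distribution"
    unfolding Y_def
  proof (rule Z.weighted_clt)
    show "integrable M (\<lambda>x. ((X x - \<mu>) / \<sigma>)\<^sup>2)"
      using X_sq X_int by (simp add: power_divide power2_diff)
    show "expectation (\<lambda>x. (X x - \<mu>) / \<sigma>) = 0"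
      using X_int by (simp add: \<mu>_def prob_space)
    have "\<sigma>\<^sup>2 = variance X" using variance_pos by (simp add: \<sigma>_def)
    then show "expectation (\<lambda>x. ((X x - \<mu>) / \<sigma>)\<^sup>2) = 1"
      using variance_pos by (simp add: power_divide \<mu>_def)
    show "(\<Sum>i=1..s j. (a j i)\<^sup>2) = 1" for j
      unfolding a_def by (rule normalised_weight(1)[OF balanced_weight_norm(1)[OF k]])
    show "\<bar>a j i\<bar> \<le> sqrt (max_weight_ratio (s j) (d j) (k j))" if "i \<in> {1..s j}" for j i
      unfolding a_def by (rule normalised_weight(2)[OF balanced_weight_norm(1)[OF k] that])
    show "(\<lambda>j. sqrt (max_weight_ratio (s j) (d j) (k j))) \<longlonglongrightarrow> 0"
      using tendsto_real_sqrt[OF balanced_max_weight_ratio[OF k]] by simp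
  qed
  from slutsky_quotient[OF Y_measurable \<tau>_measurable this continuous_cdf_std_normal \<tau> sigma_pos, of t]
  have "(\<lambda>j. prob {x \<in> space M. \<sigma> * Y j x / \<tau> j x \<le> t}) \<longlonglongrightarrow> cdf std_normal_distribution t" .
  moreover have "\<sigma> * Y j x / \<tau> j x = (\<Sum>i=1..s j. centred_weight (s j) (d j) (k j) i * Xs i x) /
      (\<tau> j x * weight_norm (s j) (d j) (k j))" for j x
  proof -
    have "(\<Sum>i=1..s j. centred_weight (s j) (d j) (k j) i) = 0"
      using k by (intro sum_centred_weight) (auto simp: balanced_counts_def)
    then have a_sum: "(\<Sum>i=1..s j. a j i) = 0"
      unfolding a_def sum_divide_distrib[symmetric] by simp
    have "\<sigma> * Y j x = (\<Sum>i=1..s j. a j i * Xs i x + (- \<mu>) * a j i)"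
      unfolding Y_def sum_distrib_left using sigma_pos
      by (intro sum.cong refl) (simp add: field_simps)
    also have "\<dots> = (\<Sum>i=1..s j. a j i * Xs i x)"
      unfolding sum.distrib sum_distrib_left[symmetric] a_sum by simp
    also have "\<dots> = (\<Sum>i=1..s j. centred_weight (s j) (d j) (k j) i * Xs i x) / weight_norm (s j) (d j) (k j)"
      unfolding sum_divide_distrib by (intro sum.cong refl) (simp add: a_def)
    finally show ?thesis by (simp add: mult.commute)
  qed
  ultimately show ?thesis by simp
qed

text \<open>
  Outside the event \<open>\<bar>\<tau> - \<sigma>\<bar> > \<sigma> / 2\<close> a summand can exceed \<open>\<epsilon>\<close> only if \<open>b * (X i)\<^sup>2\<close> is at least
  \<open>(\<epsilon> * \<sigma> / 2)\<^sup>2\<close>, where \<open>b\<close> is the maximal weight ratio. Markov's inequality bounds the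
  probability of this by a multiple of \<open>b\<close> that is the same for all \<open>i\<close>.
\<close>

lemma studentised_uan:
  assumes k: "balanced_counts s d k" and "\<epsilon> > 0"
    and [measurable]: "\<And>j. \<tau> j \<in> borel_measurable M" and \<tau>: "tendsto_in_prob M \<tau> \<sigma>"
  shows "(\<lambda>j. MAX i\<in>{1..s j}. prob {x \<in> space M. abs_summand (s j) (d j) (k j) (\<lambda>i. Xs i x) i /
      (\<tau> j x * weight_norm (s j) (d j) (k j)) > \<epsilon>}) \<longlonglongrightarrow> 0"
proof -
  define \<eta> where "\<eta> = \<epsilon> * \<sigma> / 2"
  have \<eta>: "\<eta> > 0" using \<open>\<epsilon> > 0\<close> sigma_pos by (simp add: \<eta>_def)
  define b where "b j = max_weight_ratio (s j) (d j) (k j)" for j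
  define R where "R j = prob {x \<in> space M. \<bar>\<tau> j x - \<sigma>\<bar> > \<sigma> / 2}" for j
  define bound where "bound j = R j + b j * expectation (\<lambda>x. (X x)\<^sup>2) / \<eta>\<^sup>2" for j
  have s: "s j \<ge> 1" for j using k by (simp add: balanced_counts_def)
  have b_nonneg: "b j \<ge> 0" for j
    unfolding b_def by (rule max_weight_ratio_nonneg[OF s])
  have le: "prob {x \<in> space M. abs_summand (s j) (d j) (k j) (\<lambda>i. Xs i x) i /
      (\<tau> j x * weight_norm (s j) (d j) (k j)) > \<epsilon>} \<le> bound j" if i: "i \<in> {1..s j}" for i j
  proof -
    have [measurable]: "Xs i \<in> borel_measurable M" using i by (intro Xs_measurable) simp
    define V where "V = weight_norm (s j) (d j) (k j)"
    define c where "c = centred_weight (s j) (d j) (k j) i"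
    have V: "V > 0" unfolding V_def by (rule balanced_weight_norm(1)[OF k])
    have cV: "\<bar>c / V\<bar> \<le> sqrt (b j)"
      unfolding c_def V_def b_def by (rule normalised_weight(2)[OF balanced_weight_norm(1)[OF k] i])
    have "prob {x \<in> space M. abs_summand (s j) (d j) (k j) (\<lambda>i. Xs i x) i / (\<tau> j x * V) > \<epsilon>}
      \<le> prob ({x \<in> space M. \<bar>\<tau> j x - \<sigma>\<bar> > \<sigma> / 2} \<union> {x \<in> space M. \<eta>\<^sup>2 \<le> b j * (Xs i x)\<^sup>2})"
    proof (intro finite_measure_mono subsetI)
      fix x assume x: "x \<in> {x \<in> space M. abs_summand (s j) (d j) (k j) (\<lambda>i. Xs i x) i / (\<tau> j x * V) > \<epsilon>}"
      have "\<eta>\<^sup>2 \<le> b j * (Xs i x)\<^sup>2" if "\<bar>\<tau> j x - \<sigma>\<bar> \<le> \<sigma> / 2"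
      proof -
        have \<tau>x: "\<tau> j x \<ge> \<sigma> / 2" using that by linarith
        then have "\<tau> j x > 0" using sigma_pos by linarith
        have "\<eta> \<le> \<epsilon> * \<tau> j x"
          unfolding \<eta>_def using mult_left_mono[OF \<tau>x, of \<epsilon>] \<open>\<epsilon> > 0\<close> by simp
        also have "\<epsilon> * (\<tau> j x * V) \<le> \<bar>c * Xs i x\<bar>"
          using x \<open>\<tau> j x > 0\<close> V by (simp add: abs_summand_def c_def pos_less_divide_eq)
        then have "\<epsilon> * \<tau> j x \<le> \<bar>c / V\<bar> * \<bar>Xs i x\<bar>"
          using V by (simp add: pos_le_divide_eq abs_mult mult_ac)
        also have "\<dots> \<le> sqrt (b j) * \<bar>Xs i x\<bar>"
          using cV by (rule mult_right_mono) simp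
        finally have "\<eta>\<^sup>2 \<le> (sqrt (b j) * \<bar>Xs i x\<bar>)\<^sup>2"
          using \<eta> by (intro power_mono) auto
        then show ?thesis using b_nonneg[of j] by (simp add: power_mult_distrib)
      qed
      then show "x \<in> {x \<in> space M. \<bar>\<tau> j x - \<sigma>\<bar> > \<sigma> / 2} \<union> {x \<in> space M. \<eta>\<^sup>2 \<le> b j * (Xs i x)\<^sup>2}"
        using x by (cases "\<bar>\<tau> j x - \<sigma>\<bar> \<le> \<sigma> / 2") auto
    qed simp
    also have "\<dots> \<le> R j + prob {x \<in> space M. \<eta>\<^sup>2 \<le> b j * (Xs i x)\<^sup>2}"
      unfolding R_def by (intro measure_Un_le) auto
    also have "prob {x \<in> space M. \<eta>\<^sup>2 \<le> b j * (Xs i x)\<^sup>2} \<le> expectation (\<lambda>x. b j * (Xs i x)\<^sup>2) / \<eta>\<^sup>2"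
      using i \<eta> b_nonneg integrable_Xs[of i "\<lambda>y. y\<^sup>2"] X_sq
      by (intro integral_Markov_inequality_measure[where A="space M"]) simp_all
    also have "expectation (\<lambda>x. b j * (Xs i x)\<^sup>2) = b j * expectation (\<lambda>x. (X x)\<^sup>2)"
      using i integral_Xs[of i "\<lambda>y. y\<^sup>2"] by simp
    finally show ?thesis by (simp add: V_def bound_def)
  qed
  have "R \<longlonglongrightarrow> 0"
    unfolding R_def using \<tau> sigma_pos by (intro tendsto_in_probD) auto
  moreover have "b \<longlonglongrightarrow> 0"
    unfolding b_def by (rule balanced_max_weight_ratio[OF k])
  ultimately have "bound \<longlonglongrightarrow> 0 + 0 * expectation (\<lambda>x. (X x)\<^sup>2) / \<eta>\<^sup>2"
    unfolding bound_def using \<eta> by (intro tendsto_intros) auto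
  then have bound: "bound \<longlonglongrightarrow> 0" by simp
  show ?thesis
  proof (rule Lim_null_comparison[OF always_eventually bound], rule allI)
    fix j
    define q where "q i = prob {x \<in> space M. abs_summand (s j) (d j) (k j) (\<lambda>i. Xs i x) i /
      (\<tau> j x * weight_norm (s j) (d j) (k j)) > \<epsilon>}" for i
    have "Max (q ` {1..s j}) \<in> q ` {1..s j}" using s[of j] by (intro Max_in) auto
    then obtain i where i: "i \<in> {1..s j}" "Max (q ` {1..s j}) = q i" by auto
    have "q i \<ge> 0" by (simp add: q_def)
    moreover have "q i \<le> bound j" unfolding q_def by (rule le[OF i(1)])
    ultimately have "norm (Max (q ` {1..s j})) \<le> bound j" unfolding i(2) by simp
    then show "norm (MAX i\<in>{1..s j}. prob {x \<in> space M. abs_summand (s j) (d j) (k j) (\<lambda>i. Xs i x) i /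
      (\<tau> j x * weight_norm (s j) (d j) (k j)) > \<epsilon>}) \<le> bound j"
      unfolding q_def .
  qed
qed

text \<open>
  Dividing by \<open>sqrt N * weight_norm\<close>, which tends to \<open>1\<close>, brings the denominator
  \<open>boot_sd / sqrt N\<close> of the second statistic into the form \<open>\<tau> * weight_norm\<close>.
\<close>

lemma scaled_boot_sd_tendsto:
  assumes k: "balanced_counts s d k"
  shows "tendsto_in_prob M (\<lambda>j x. boot_sd (s j) (d j) (k j) (\<lambda>i. Xs i x) /
      (sqrt (real (d j)) * weight_norm (s j) (d j) (k j))) \<sigma>"
proof -
  have "(\<lambda>j. sqrt (real (d j)) * weight_norm (s j) (d j) (k j)) \<longlonglongrightarrow> sqrt 1"
    using tendsto_real_sqrt[OF balanced_weight_norm(2)[OF k]] balanced_weight_norm(1)[OF k]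
    by (simp add: real_sqrt_mult less_imp_le)
  then have "tendsto_in_prob M (\<lambda>j x. sqrt (real (d j)) * weight_norm (s j) (d j) (k j)) 1"
    by (intro tendsto_in_prob_const) simp
  then have "tendsto_in_prob M (\<lambda>j x. boot_sd (s j) (d j) (k j) (\<lambda>i. Xs i x) /
      (sqrt (real (d j)) * weight_norm (s j) (d j) (k j))) (\<sigma> / 1)"
    by (intro tendsto_in_prob_isCont2[where f="\<lambda>u v. u / v"] boot_sd_tendsto[OF k] continuous_intros
        boot_sd_measurable) auto
  then show ?thesis by simp
qed

lemma weighted_sum_Xs_measurable [measurable]: "(\<lambda>x. \<Sum>i=1..n. p i * Xs i x) \<in> borel_measurable M"
  using weighted_sum_measurable[of "\<lambda>y. y"] by simp

lemma T_star_measurable [measurable]: "(\<lambda>x. T_star n N k (\<lambda>i. Xs i x)) \<in> borel_measurable M"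
  unfolding T_star_def by measurable

lemma T_star2_measurable [measurable]: "(\<lambda>x. T_star2 n N k (\<lambda>i. Xs i x)) \<in> borel_measurable M"
  unfolding T_star2_def by measurable

lemma abs_summand_measurable:
  "i \<in> {1..n} \<Longrightarrow> (\<lambda>x. abs_summand n N k (\<lambda>i. Xs i x) i) \<in> borel_measurable M"
  unfolding abs_summand_def
  by (intro borel_measurable_abs borel_measurable_times borel_measurable_const Xs_measurable) simp

lemma boot_sd_normalised:
  assumes "balanced_counts s d k"
  shows "boot_sd (s j) (d j) (k j) x / sqrt (real (d j))
    = boot_sd (s j) (d j) (k j) x / (sqrt (real (d j)) * weight_norm (s j) (d j) (k j)) * weight_norm (s j) (d j) (k j)"
  using balanced_weight_norm(1)[OF assms, of j] by simp

lemma T_star_clt: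
  assumes k: "balanced_counts s d k"
  shows "(\<lambda>j. prob {x \<in> space M. T_star (s j) (d j) (k j) (\<lambda>i. Xs i x) \<le> t}) \<longlonglongrightarrow> cdf std_normal_distribution t"
  using studentised_clt[OF k sample_sd_measurable sample_sd_tendsto[OF k]]
  unfolding T_star_def weight_norm_def .

lemma T_star2_clt:
  assumes k: "balanced_counts s d k"
  shows "(\<lambda>j. prob {x \<in> space M. T_star2 (s j) (d j) (k j) (\<lambda>i. Xs i x) \<le> t}) \<longlonglongrightarrow> cdf std_normal_distribution t"
  unfolding T_star2_def boot_sd_normalised[OF k]
  by (rule studentised_clt[OF k _ scaled_boot_sd_tendsto[OF k]]) measurable

end

section \<open>Conditional probability given the weights\<close>

lemma centred_weight_cong: "k i = k' i \<Longrightarrow> centred_weight n N k i = centred_weight n N k' i"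
  by (simp add: centred_weight_def)

lemma determined_on_weight_norm: "determined_on n (weight_norm n N)"
  unfolding determined_on_def weight_norm_def
proof (intro allI impI arg_cong[of _ _ sqrt] sum.cong refl)
  fix k k' :: "nat \<Rightarrow> nat" and i assume "\<forall>i\<in>{1..n}. k i = k' i" "i \<in> {1..n}"
  then have "centred_weight n N k i = centred_weight n N k' i" by (intro centred_weight_cong) blast
  then show "(centred_weight n N k i)\<^sup>2 = (centred_weight n N k' i)\<^sup>2" by (simp only:)
qed

lemma determined_on_sum_centred_weight: "determined_on n (\<lambda>k. \<Sum>i=1..n. centred_weight n N k i * x i)"
  unfolding determined_on_def
proof (intro allI impI sum.cong refl)
  fix k k' :: "nat \<Rightarrow> nat" and i assume "\<forall>i\<in>{1..n}. k i = k' i" "i \<in> {1..n}"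
  then have "centred_weight n N k i = centred_weight n N k' i" by (intro centred_weight_cong) blast
  then show "centred_weight n N k i * x i = centred_weight n N k' i * x i" by (simp only:)
qed

lemma determined_on_boot_sd: "determined_on n (\<lambda>k. boot_sd n N k x)"
proof -
  have "boot_sd n N k x = boot_sd n N k' x" if "\<forall>i\<in>{1..n}. k i = k' i" for k k'
  proof -
    have mean: "boot_mean n N k x = boot_mean n N k' x"
      unfolding boot_mean_def using that by (intro arg_cong2[of _ _ _ _ "(*)"] sum.cong) auto
    show ?thesis
      unfolding boot_sd_def mean using that
      by (intro arg_cong[of _ _ sqrt] arg_cong2[of _ _ _ _ "(*)"] sum.cong) auto
  qed
  then show ?thesis by (simp add: determined_on_def)
qed

lemma determined_on_T_star: "determined_on n (\<lambda>k. T_star n N k x)"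
  unfolding T_star_def weight_norm_def[symmetric]
  by (rule determined_on_compose2[OF determined_on_sum_centred_weight determined_on_weight_norm,
        where h = "\<lambda>a b. a / (sample_sd n x * b)"])

lemma determined_on_T_star2: "determined_on n (\<lambda>k. T_star2 n N k x)"
  unfolding T_star2_def
  by (rule determined_on_compose2[OF determined_on_sum_centred_weight determined_on_boot_sd,
        where h = "\<lambda>a b. a / (b / sqrt (real N))"])

lemma determined_on_abs_summand: "i \<in> {1..n} \<Longrightarrow> determined_on n (\<lambda>k. abs_summand n N k x i)"
  unfolding determined_on_def abs_summand_def
proof (intro allI impI)
  fix k k' :: "nat \<Rightarrow> nat" assume "i \<in> {1..n}" "\<forall>i\<in>{1..n}. k i = k' i"
  then have "centred_weight n N k i = centred_weight n N k' i" by (intro centred_weight_cong) blast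
  then show "\<bar>centred_weight n N k i * x i\<bar> = \<bar>centred_weight n N k' i * x i\<bar>" by (simp only:)
qed

text \<open>
  The weights take countably many values, so joint measurability follows from measurability in
  the data for each value.
\<close>

lemma sets_joint_event:
  assumes W: "\<And>i. i \<in> {1..n} \<Longrightarrow> W i \<in> measurable Pw (count_space UNIV)"
    and A: "\<And>k. {x \<in> space PX. A k x} \<in> sets PX" and det: "\<And>x. determined_on n (\<lambda>k. A k x)"
  shows "{z \<in> space (PX \<Otimes>\<^sub>M Pw). A (\<lambda>i. W i (snd z)) (fst z)} \<in> sets (PX \<Otimes>\<^sub>M Pw)"
proof -
  define I where "I = {1..n} \<rightarrow>\<^sub>E (UNIV :: nat set)"
  have I: "countable I" unfolding I_def by (intro countable_PiE) auto
  define E where "E k = {\<omega> \<in> space Pw. \<forall>i\<in>{1..n}. W i \<omega> = k i}" for k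
  have E: "E k \<in> sets Pw" for k
    unfolding E_def by (rule sets_count_event[OF W]) (auto simp: determined_on_def)
  have agree: "A (\<lambda>i. W i \<omega>) x = A k x" if "\<forall>i\<in>{1..n}. W i \<omega> = k i" for x \<omega> k
    using that by (intro determined_onD[OF det]) simp
  have "{z \<in> space (PX \<Otimes>\<^sub>M Pw). A (\<lambda>i. W i (snd z)) (fst z)} = (\<Union>k\<in>I. {x \<in> space PX. A k x} \<times> E k)"
  proof (intro equalityI subsetI)
    fix z assume z: "z \<in> {z \<in> space (PX \<Otimes>\<^sub>M Pw). A (\<lambda>i. W i (snd z)) (fst z)}"
    define k where "k = (\<lambda>i\<in>{1..n}. W i (snd z))"
    have "\<forall>i\<in>{1..n}. W i (snd z) = k i" "k \<in> I" by (auto simp: k_def I_def)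
    moreover from this have "A k (fst z)" using z agree[of "snd z" k] by simp
    ultimately have "z \<in> {x \<in> space PX. A k x} \<times> E k"
      using z by (cases z) (simp add: space_pair_measure E_def)
    with \<open>k \<in> I\<close> show "z \<in> (\<Union>k\<in>I. {x \<in> space PX. A k x} \<times> E k)" by blast
  next
    fix z assume "z \<in> (\<Union>k\<in>I. {x \<in> space PX. A k x} \<times> E k)"
    then obtain k where k: "z \<in> {x \<in> space PX. A k x} \<times> E k" by blast
    then have "A (\<lambda>i. W i (snd z)) (fst z) = A k (fst z)"
      by (intro agree) (auto simp: E_def)
    with k show "z \<in> {z \<in> space (PX \<Otimes>\<^sub>M Pw). A (\<lambda>i. W i (snd z)) (fst z)}"
      by (cases z) (simp add: space_pair_measure E_def)
  qed
  also have "\<dots> \<in> sets (PX \<Otimes>\<^sub>M Pw)"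
    using I A E by (intro sets.countable_UN') auto
  finally show ?thesis .
qed

text \<open>
  By Fubini, both sides have the same integral over every event of \<^const>\<open>weight_algebra\<close>, as
  such an event restricts the second coordinate only, and the right-hand side is a function of the
  weights.
\<close>

lemma cond_prob_weights_eq:
  assumes "prob_space PX" and "prob_space Pw"
    and W: "\<And>i. i \<in> {1..n} \<Longrightarrow> W i \<in> measurable Pw (count_space UNIV)"
    and A: "\<And>k. {x \<in> space PX. A k x} \<in> sets PX" and det: "\<And>x. determined_on n (\<lambda>k. A k x)"
  shows "AE z in PX \<Otimes>\<^sub>M Pw. cond_prob_weights PX Pw n W (\<lambda>x \<omega>. A (\<lambda>i. W i \<omega>) x) z
     = measure PX {x \<in> space PX. A (\<lambda>i. W i (snd z)) x}"
proof -
  interpret PX: prob_space PX by fact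
  interpret Pw: prob_space Pw by fact
  interpret P: pair_prob_space PX Pw ..
  let ?P = "PX \<Otimes>\<^sub>M Pw" and ?F = "weight_algebra PX Pw n W"
  have subalg: "subalgebra ?P ?F" by (rule subalgebra_weight_algebra[OF W])
  have F: "sigma_finite_subalgebra ?P ?F"
    using subalg P.finite_measure_axioms
    by (intro finite_measure_subalgebra_is_sigma_finite)
      (simp add: finite_measure_subalgebra_def finite_measure_subalgebra_axioms_def)
  define G where "G k = measure PX {x \<in> space PX. A k x}" for k
  have G_det: "determined_on n G"
    unfolding determined_on_def
  proof (intro allI impI)
    fix k k' :: "nat \<Rightarrow> nat" assume "\<forall>i\<in>{1..n}. k i = k' i"
    then have "A k = A k'" by (intro ext determined_onD[OF det]) blast
    then show "G k = G k'" by (simp only: G_def)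
  qed
  define Q where "Q = {z \<in> space ?P. A (\<lambda>i. W i (snd z)) (fst z)}"
  have Q: "Q \<in> sets ?P"
    unfolding Q_def by (rule sets_joint_event[OF W A det])
  have G_measurable: "(\<lambda>\<omega>. G (\<lambda>i. W i \<omega>)) \<in> borel_measurable Pw"
  proof (rule measurableI)
    fix S :: "real set"
    have "{\<omega> \<in> space Pw. G (\<lambda>i. W i \<omega>) \<in> S} \<in> sets Pw"
      by (rule sets_count_event[OF W determined_on_compose[OF G_det]])
    then show "(\<lambda>\<omega>. G (\<lambda>i. W i \<omega>)) -` S \<inter> space Pw \<in> sets Pw"
      by (simp add: vimage_def Int_def conj_commute)
  qed simp
  have G_F: "(\<lambda>z. G (\<lambda>i. W i (snd z))) \<in> borel_measurable ?F"
  proof (rule measurableI)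
    fix S :: "real set"
    have "{v \<in> {1..n} \<rightarrow>\<^sub>E UNIV. G v \<in> S} \<in> sets (\<Pi>\<^sub>M i\<in>{1..n}. count_space (UNIV :: nat set))"
      by (subst count_space_PiM_finite) auto
    moreover have "G (\<lambda>i. W i \<omega>) = G (\<lambda>i\<in>{1..n}. W i \<omega>)" for \<omega>
      by (rule determined_onD[OF G_det]) simp
    then have "(\<lambda>z. G (\<lambda>i. W i (snd z))) -` S \<inter> space ?F
        = {z \<in> space ?P. (\<lambda>i\<in>{1..n}. W i (snd z)) \<in> {v \<in> {1..n} \<rightarrow>\<^sub>E UNIV. G v \<in> S}}"
      by (auto simp: weight_algebra_def)
    ultimately show "(\<lambda>z. G (\<lambda>i. W i (snd z))) -` S \<inter> space ?F \<in> sets ?F"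
      unfolding weight_algebra_eq by blast
  qed simp
  have G_bounded: "\<bar>G k\<bar> \<le> 1" for k by (simp add: G_def)
  have G_int: "integrable ?P (\<lambda>z. G (\<lambda>i. W i (snd z)))"
    by (rule P.integrable_const_bound[where B=1])
      (use G_bounded measurable_compose[OF measurable_snd G_measurable] in auto)
  have Q_int: "integrable ?P (indicat_real Q)"
    using Q by (intro integrable_real_indicator) (auto simp: P.emeasure_eq_measure)
  have "AE z in ?P. real_cond_exp ?P ?F (indicat_real Q) z = G (\<lambda>i. W i (snd z))"
  proof (rule sigma_finite_subalgebra.real_cond_exp_charact[OF F _ Q_int G_int G_F])
    fix B assume B: "B \<in> sets ?F"
    then obtain B' where B': "B = {z \<in> space ?P. (\<lambda>i\<in>{1..n}. W i (snd z)) \<in> B'}"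
      unfolding weight_algebra_eq by blast
    \<comment> \<open>\<open>B\<close> is a cylinder over the event \<open>C\<close> in the second coordinate, so its indicator is a constant
      in the inner integral.\<close>
    define C where "C = {\<omega> \<in> space Pw. (\<lambda>i\<in>{1..n}. W i \<omega>) \<in> B'}"
    have BC: "indicat_real B (x, \<omega>) = indicat_real C \<omega>" if "x \<in> space PX" for x \<omega>
      using that by (auto simp: B' C_def space_pair_measure split: split_indicator)
    have B_P: "B \<in> sets ?P" using B subalg by (auto simp: subalgebra_def)
    have "(\<integral>z\<in>B. indicat_real Q z \<partial>?P) = (\<integral>z. (case z of (x, \<omega>) \<Rightarrow> indicat_real B (x, \<omega>) * indicat_real Q (x, \<omega>)) \<partial>?P)"
      by (simp add: set_lebesgue_integral_def case_prod_unfold)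
    also have "\<dots> = (\<integral>\<omega>. \<integral>x. indicat_real B (x, \<omega>) * indicat_real Q (x, \<omega>) \<partial>PX \<partial>Pw)"
      using integrable_mult_indicator[OF B_P Q_int]
      by (intro P.integral_snd[symmetric]) (simp add: case_prod_unfold)
    also have "\<dots> = (\<integral>\<omega>. \<integral>x. indicat_real B (x, \<omega>) * G (\<lambda>i. W i \<omega>) \<partial>PX \<partial>Pw)"
    proof (rule Bochner_Integration.integral_cong[OF refl])
      fix \<omega> assume \<omega>: "\<omega> \<in> space Pw"
      have "(\<integral>x. indicat_real B (x, \<omega>) * indicat_real Q (x, \<omega>) \<partial>PX)
          = (\<integral>x. indicat_real C \<omega> * indicat_real {x \<in> space PX. A (\<lambda>i. W i \<omega>) x} x \<partial>PX)"
        using \<omega> by (intro Bochner_Integration.integral_cong refl)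
          (auto simp: BC Q_def space_pair_measure split: split_indicator)
      also have "\<dots> = indicat_real C \<omega> * G (\<lambda>i. W i \<omega>)"
        using A by (simp add: G_def)
      also have "\<dots> = (\<integral>x. indicat_real C \<omega> * G (\<lambda>i. W i \<omega>) \<partial>PX)"
        by (simp add: PX.prob_space)
      also have "\<dots> = (\<integral>x. indicat_real B (x, \<omega>) * G (\<lambda>i. W i \<omega>) \<partial>PX)"
        by (intro Bochner_Integration.integral_cong refl) (simp add: BC)
      finally show "(\<integral>x. indicat_real B (x, \<omega>) * indicat_real Q (x, \<omega>) \<partial>PX)
          = (\<integral>x. indicat_real B (x, \<omega>) * G (\<lambda>i. W i \<omega>) \<partial>PX)" .
    qed
    also have "\<dots> = (\<integral>z. (case z of (x, \<omega>) \<Rightarrow> indicat_real B (x, \<omega>) * G (\<lambda>i. W i \<omega>)) \<partial>?P)"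
      using integrable_mult_indicator[OF B_P G_int]
      by (intro P.integral_snd) (simp add: case_prod_unfold)
    also have "\<dots> = (\<integral>z\<in>B. G (\<lambda>i. W i (snd z)) \<partial>?P)"
      by (simp add: set_lebesgue_integral_def case_prod_unfold)
    finally show "(\<integral>z\<in>B. indicat_real Q z \<partial>?P) = (\<integral>z\<in>B. G (\<lambda>i. W i (snd z)) \<partial>?P)" .
  qed
  then show ?thesis
    by (simp add: cond_prob_weights_def Q_def G_def)
qed

text \<open>
  If the claim failed for every \<open>\<delta> = 1 / (j + 2)\<close>, sizes \<open>s j > j\<close> and counts \<open>k j\<close> violating it
  would form a balanced sequence along which \<open>g\<close> does not tend to \<open>c\<close>.
\<close>

lemma uniform_on_good_counts:
  assumes m: "filterlim m at_top sequentially" and "\<epsilon> > 0"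
    and lim: "\<And>s k. balanced_counts s (\<lambda>j. m (s j)) k \<Longrightarrow> (\<lambda>j. g (s j) (k j) :: real) \<longlonglongrightarrow> c"
  obtains \<delta> where "\<delta> > 0"
    and "\<forall>\<^sub>F n in sequentially. \<forall>k. (\<Sum>i=1..n. k i) = m n \<longrightarrow> weight_defect n (m n) k \<le> \<delta> \<longrightarrow> \<bar>g n k - c\<bar> \<le> \<epsilon>"
proof (rule ccontr)
  assume no: "\<not> thesis"
  have "\<exists>n\<ge>j + 1. m n \<ge> 1 \<and> (\<exists>k. (\<Sum>i=1..n. k i) = m n \<and> weight_defect n (m n) k \<le> 1 / (real j + 2) \<and> \<bar>g n k - c\<bar> > \<epsilon>)"
    for j :: nat
  proof (rule ccontr)
    assume neg: "\<not> ?thesis"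
    have "\<forall>\<^sub>F n in sequentially. n \<ge> j + 1 \<and> m n \<ge> 1"
      using m by (intro eventually_conj eventually_ge_at_top) (simp add: filterlim_at_top)
    then have "\<forall>\<^sub>F n in sequentially. \<forall>k. (\<Sum>i=1..n. k i) = m n \<longrightarrow>
        weight_defect n (m n) k \<le> 1 / (real j + 2) \<longrightarrow> \<bar>g n k - c\<bar> \<le> \<epsilon>"
    proof (rule eventually_mono, intro allI impI)
      fix n k
      assume "n \<ge> j + 1 \<and> m n \<ge> 1" "(\<Sum>i=1..n. k i) = m n" "weight_defect n (m n) k \<le> 1 / (real j + 2)"
      then show "\<bar>g n k - c\<bar> \<le> \<epsilon>" using neg by (meson not_le)
    qed
    then show False using no that[of "1 / (real j + 2)"] by simp
  qed
  then obtain s k where s: "\<And>j. s j \<ge> j + 1" "\<And>j. m (s j) \<ge> 1"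
    and sum: "\<And>j. (\<Sum>i=1..s j. k j i) = m (s j)"
    and defect: "\<And>j. weight_defect (s j) (m (s j)) (k j) \<le> 1 / (real j + 2)"
    and far: "\<And>j. \<bar>g (s j) (k j) - c\<bar> > \<epsilon>"
    by metis
  have s_lim: "filterlim s at_top sequentially"
    using s(1) by (intro filterlim_at_top_mono[OF filterlim_Suc]) auto
  have nonneg: "0 \<le> weight_defect (s j) (m (s j)) (k j)" for j
    using max_weight_ratio_nonneg[of "s j"] s(1)[of j] by (simp add: weight_defect_def)
  have "balanced_counts s (\<lambda>j. m (s j)) k"
    unfolding balanced_counts_def
  proof (intro conjI allI)
    show "s j \<ge> 1" "m (s j) \<ge> 1" "(\<Sum>i=1..s j. k j i) = m (s j)" for j
      using s[of j] sum[of j] by auto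
    have "1 / (real j + 2) \<le> 1 / 2" for j by (simp add: field_simps)
    then show "weight_defect (s j) (m (s j)) (k j) \<le> 1 / 2" for j
      using defect order_trans by blast
    show "filterlim s at_top sequentially" by fact
    show "filterlim (\<lambda>j. m (s j)) at_top sequentially"
      by (rule filterlim_compose[OF m s_lim])
    have "(\<lambda>j. 1 / real (Suc (Suc j))) \<longlonglongrightarrow> 0"
      using LIMSEQ_Suc[OF LIMSEQ_Suc[OF lim_const_over_n[of 1]]] .
    then have "(\<lambda>j. 1 / (real j + 2)) \<longlonglongrightarrow> 0"
      by (simp add: add.commute)
    then show "(\<lambda>j. weight_defect (s j) (m (s j)) (k j)) \<longlonglongrightarrow> 0"
      by (rule Lim_null_comparison[rotated]) (use nonneg defect in \<open>auto intro!: always_eventually\<close>)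
  qed
  from tendstoD[OF lim[OF this] \<open>\<epsilon> > 0\<close>] have "\<forall>\<^sub>F j in sequentially. False"
    by (rule eventually_mono) (use far less_asym in \<open>auto simp: dist_real_def\<close>)
  then show False by simp
qed

text \<open>
  Almost surely the counts sum to \<open>m n\<close>, so \<open>g\<close> can be far from \<open>c\<close> only where the weight defect
  exceeds the \<open>\<delta>\<close> of \<open>uniform_on_good_counts\<close>.
\<close>

lemma tendsto_in_prob_of_counts:
  assumes PX: "prob_space PX" and Pw: "prob_space Pw"
    and W: "\<And>n. n \<ge> 1 \<Longrightarrow> multinomial_distributed Pw n (m n) (\<lambda>_. 1 / real n) (w n)"
    and m: "filterlim m at_top sequentially"
    and Y: "\<And>n. n \<ge> 1 \<Longrightarrow> AE z in PX \<Otimes>\<^sub>M Pw. Y n z = g n (\<lambda>i. w n i (snd z))"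
    and lim: "\<And>s k. balanced_counts s (\<lambda>j. m (s j)) k \<Longrightarrow> (\<lambda>j. g (s j) (k j)) \<longlonglongrightarrow> c"
  shows "tendsto_in_prob (PX \<Otimes>\<^sub>M Pw) Y c"
  unfolding tendsto_in_prob_def
proof (intro allI impI)
  fix \<epsilon> :: real assume "\<epsilon> > 0"
  interpret PX: prob_space PX by fact
  interpret Pw: prob_space Pw by fact
  interpret P: pair_prob_space PX Pw ..
  obtain \<delta> where "\<delta> > 0" and \<delta>: "\<forall>\<^sub>F n in sequentially. \<forall>k. (\<Sum>i=1..n. k i) = m n \<longrightarrow>
      weight_defect n (m n) k \<le> \<delta> \<longrightarrow> \<bar>g n k - c\<bar> \<le> \<epsilon>"
    using uniform_on_good_counts[where g = g and c = c, OF m \<open>\<epsilon> > 0\<close> lim] by blast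
  let ?D = "\<lambda>n. {\<omega> \<in> space Pw. \<bar>weight_defect n (m n) (\<lambda>i. w n i \<omega>) - 0\<bar> > \<delta>}"
  have D: "(\<lambda>n. Pw.prob (?D n)) \<longlonglongrightarrow> 0"
    using tendsto_in_probD[OF tendsto_weight_defect[OF Pw W m] \<open>\<delta> > 0\<close>] .
  have "\<forall>\<^sub>F n in sequentially. P.prob {z \<in> space (PX \<Otimes>\<^sub>M Pw). \<bar>Y n z - c\<bar> > \<epsilon>} \<le> Pw.prob (?D n)"
    using \<delta> eventually_ge_at_top[of 1]
  proof eventually_elim
    case (elim n)
    then have n: "n \<ge> 1" by simp
    have Wm: "\<And>i. i \<in> {1..n} \<Longrightarrow> w n i \<in> measurable Pw (count_space UNIV)"
      using W[OF n] by (auto simp: multinomial_distributed_def)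
    define C where "C = {\<omega> \<in> space Pw. \<bar>weight_defect n (m n) (\<lambda>i. w n i \<omega>) - 0\<bar> > \<delta> \<or> (\<Sum>i=1..n. w n i \<omega>) \<noteq> m n}"
    have nonneg: "0 \<le> weight_defect n (m n) k" for k
      using max_weight_ratio_nonneg[OF n] by (simp add: weight_defect_def)
    have D_sets: "?D n \<in> sets Pw"
      using sets_count_event[OF Wm determined_on_weight_defect[of n \<delta> "m n"]] nonneg by simp
    have sum_sets: "{\<omega> \<in> space Pw. (\<Sum>i=1..n. w n i \<omega>) \<noteq> m n} \<in> sets Pw"
      by (rule sets_count_event[OF Wm, where Q="\<lambda>k. (\<Sum>i=1..n. k i) \<noteq> m n"]) (auto simp: determined_on_def)
    have "C = ?D n \<union> {\<omega> \<in> space Pw. (\<Sum>i=1..n. w n i \<omega>) \<noteq> m n}"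
      by (auto simp: C_def)
    then have C_sets: "C \<in> sets Pw" using D_sets sum_sets by simp
    have "P.prob {z \<in> space (PX \<Otimes>\<^sub>M Pw). \<bar>Y n z - c\<bar> > \<epsilon>} \<le> P.prob (space PX \<times> C)"
    proof (rule P.finite_measure_mono_AE)
      show "AE z in PX \<Otimes>\<^sub>M Pw. z \<in> {z \<in> space (PX \<Otimes>\<^sub>M Pw). \<bar>Y n z - c\<bar> > \<epsilon>} \<longrightarrow> z \<in> space PX \<times> C"
      proof (rule AE_mp[OF Y[OF n]], rule AE_I2, intro impI)
        fix z assume "Y n z = g n (\<lambda>i. w n i (snd z))"
          and "z \<in> {z \<in> space (PX \<Otimes>\<^sub>M Pw). \<bar>Y n z - c\<bar> > \<epsilon>}"
        then have z: "fst z \<in> space PX" "snd z \<in> space Pw" "\<not> \<bar>g n (\<lambda>i. w n i (snd z)) - c\<bar> \<le> \<epsilon>"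
          by (auto simp: space_pair_measure)
        have "(\<Sum>i=1..n. w n i (snd z)) = m n \<Longrightarrow> \<not> weight_defect n (m n) (\<lambda>i. w n i (snd z)) \<le> \<delta>"
          using elim(1) z(3) by blast
        with z(1,2) have "fst z \<in> space PX" "snd z \<in> C"
          unfolding C_def by (simp, fastforce)
        then show "z \<in> space PX \<times> C" by (cases z) simp
      qed
    qed (use C_sets in simp)
    also have "\<dots> = Pw.prob C"
      using C_sets by (simp add: measure_def Pw.emeasure_pair_measure_Times PX.emeasure_space_1)
    also have "\<dots> = Pw.prob (?D n)"
    proof (rule Pw.finite_measure_eq_AE[OF _ C_sets D_sets])
      show "AE \<omega> in Pw. \<omega> \<in> C \<longleftrightarrow> \<omega> \<in> ?D n"
        using multinomial_sum[OF Pw W[OF n] n] by eventually_elim (auto simp: C_def)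
    qed
    finally show ?case .
  qed
  then show "(\<lambda>n. P.prob {z \<in> space (PX \<Otimes>\<^sub>M Pw). \<bar>Y n z - c\<bar> > \<epsilon>}) \<longlonglongrightarrow> 0"
    by (intro tendsto_sandwich[OF always_eventually _ tendsto_const D]) auto
qed

lemma tendsto_in_prob_cond_prob:
  assumes PX: "prob_space PX" and Pw: "prob_space Pw"
    and W: "\<And>n. n \<ge> 1 \<Longrightarrow> multinomial_distributed Pw n (m n) (\<lambda>_. 1 / real n) (w n)"
    and m: "filterlim m at_top sequentially"
    and A: "\<And>n k. {x \<in> space PX. A n k x} \<in> sets PX" and det: "\<And>n x. determined_on n (\<lambda>k. A n k x)"
    and lim: "\<And>s k. balanced_counts s (\<lambda>j. m (s j)) k \<Longrightarrow>
      (\<lambda>j. measure PX {x \<in> space PX. A (s j) (k j) x}) \<longlonglongrightarrow> c"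
  shows "tendsto_in_prob (PX \<Otimes>\<^sub>M Pw) (\<lambda>n. cond_prob_weights PX Pw n (w n) (\<lambda>x \<omega>. A n (\<lambda>i. w n i \<omega>) x)) c"
proof (rule tendsto_in_prob_of_counts[OF PX Pw W m])
  show "AE z in PX \<Otimes>\<^sub>M Pw. cond_prob_weights PX Pw n (w n) (\<lambda>x \<omega>. A n (\<lambda>i. w n i \<omega>) x) z
      = measure PX {x \<in> space PX. A n (\<lambda>i. w n i (snd z)) x}" if "n \<ge> 1" for n
    using W[OF that] by (intro cond_prob_weights_eq[OF PX Pw _ A det]) (auto simp: multinomial_distributed_def)
qed (assumption | rule lim)+

lemma tendsto_in_prob_Max_cond_prob:
  assumes PX: "prob_space PX" and Pw: "prob_space Pw"
    and W: "\<And>n. n \<ge> 1 \<Longrightarrow> multinomial_distributed Pw n (m n) (\<lambda>_. 1 / real n) (w n)"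
    and m: "filterlim m at_top sequentially"
    and A: "\<And>n i k. i \<in> {1..n} \<Longrightarrow> {x \<in> space PX. A n i k x} \<in> sets PX"
    and det: "\<And>n i x. i \<in> {1..n} \<Longrightarrow> determined_on n (\<lambda>k. A n i k x)"
    and lim: "\<And>s k. balanced_counts s (\<lambda>j. m (s j)) k \<Longrightarrow>
      (\<lambda>j. MAX i\<in>{1..s j}. measure PX {x \<in> space PX. A (s j) i (k j) x}) \<longlonglongrightarrow> c"
  shows "tendsto_in_prob (PX \<Otimes>\<^sub>M Pw) (\<lambda>n z. MAX i\<in>{1..n}.
    cond_prob_weights PX Pw n (w n) (\<lambda>x \<omega>. A n i (\<lambda>i. w n i \<omega>) x) z) c"
proof (rule tendsto_in_prob_of_counts[OF PX Pw W m])
  fix n :: nat assume n: "n \<ge> 1"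
  have "AE z in PX \<Otimes>\<^sub>M Pw. \<forall>i\<in>{1..n}. cond_prob_weights PX Pw n (w n) (\<lambda>x \<omega>. A n i (\<lambda>i. w n i \<omega>) x) z
      = measure PX {x \<in> space PX. A n i (\<lambda>i. w n i (snd z)) x}"
  proof (rule AE_finite_allI)
    fix i assume i: "i \<in> {1..n}"
    show "AE z in PX \<Otimes>\<^sub>M Pw. cond_prob_weights PX Pw n (w n) (\<lambda>x \<omega>. A n i (\<lambda>i. w n i \<omega>) x) z
      = measure PX {x \<in> space PX. A n i (\<lambda>i. w n i (snd z)) x}"
      using W[OF n] by (intro cond_prob_weights_eq[OF PX Pw _ A[OF i] det[OF i]])
        (auto simp: multinomial_distributed_def)
  qed simp
  then show "AE z in PX \<Otimes>\<^sub>M Pw. (MAX i\<in>{1..n}. cond_prob_weights PX Pw n (w n) (\<lambda>x \<omega>. A n i (\<lambda>i. w n i \<omega>) x) z)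
      = (MAX i\<in>{1..n}. measure PX {x \<in> space PX. A n i (\<lambda>i. w n i (snd z)) x})"
    by eventually_elim (intro arg_cong[of _ _ Max] image_cong, auto)
qed (assumption | rule lim)+

section \<open>Equivalence of negligible weights and the bootstrap limit theorems\<close>

theorem corollary2p1:
  fixes PX :: "'a measure" and Pw :: "'b measure"
    and X :: "'a \<Rightarrow> real" and Xs :: "nat \<Rightarrow> 'a \<Rightarrow> real"
    and m :: "nat \<Rightarrow> nat" and w :: "nat \<Rightarrow> nat \<Rightarrow> 'b \<Rightarrow> nat"
  assumes "prob_space PX" and "prob_space Pw"
    and "X \<in> borel_measurable PX"
    and "prob_space.indep_vars PX (\<lambda>_. borel) Xs {1..}"
    and "\<And>i. i \<ge> 1 \<Longrightarrow> distr PX borel (Xs i) = distr PX borel X"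
    and "integrable PX (\<lambda>x. (X x)\<^sup>2)"
    and "prob_space.variance PX X > 0"
    and "\<And>n. n \<ge> 1 \<Longrightarrow> multinomial_distributed Pw n (m n) (\<lambda>_. 1 / real n) (w n)"
    and "filterlim m at_top sequentially"
    and "(\<lambda>n. real (m n)) \<in> o(\<lambda>n. (real n)\<^sup>2)"
  defines "P \<equiv> PX \<Otimes>\<^sub>M Pw"
    and "data \<equiv> \<lambda>(x :: 'a) i. Xs i x"
    and "wt \<equiv> \<lambda>n (\<omega> :: 'b) i. w n i \<omega>"
  defines "M_negligible \<equiv>
        tendsto_in_prob Pw (\<lambda>n \<omega>. max_weight_ratio n (m n) (wt n \<omega>)) 0"
    and "CLT \<equiv> \<forall>t. tendsto_in_prob P
        (\<lambda>n. cond_prob_weights PX Pw n (w n) (\<lambda>x \<omega>. T_star n (m n) (wt n \<omega>) (data x) \<le> t))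
        (cdf std_normal_distribution t)"
    and "UAN \<equiv> \<forall>\<epsilon>>0. tendsto_in_prob P
        (\<lambda>n z. MAX i\<in>{1..n}. cond_prob_weights PX Pw n (w n)
            (\<lambda>x \<omega>. abs_summand n (m n) (wt n \<omega>) (data x) i /
                     (sample_sd n (data x) * weight_norm n (m n) (wt n \<omega>)) > \<epsilon>) z) 0"
    and "CLT2 \<equiv> \<forall>t. tendsto_in_prob P
        (\<lambda>n. cond_prob_weights PX Pw n (w n) (\<lambda>x \<omega>. T_star2 n (m n) (wt n \<omega>) (data x) \<le> t))
        (cdf std_normal_distribution t)"
    and "UAN2 \<equiv> \<forall>\<epsilon>>0. tendsto_in_prob P
        (\<lambda>n z. MAX i\<in>{1..n}. cond_prob_weights PX Pw n (w n)
            (\<lambda>x \<omega>. abs_summand n (m n) (wt n \<omega>) (data x) i /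
                     (boot_sd n (m n) (wt n \<omega>) (data x) / sqrt (real (m n))) > \<epsilon>) z) 0"
  shows "((M_negligible \<longleftrightarrow> CLT \<and> UAN) \<and> CLT) \<and>
         ((\<lambda>n. real n) \<in> o(\<lambda>n. real (m n)) \<longrightarrow> (M_negligible \<longleftrightarrow> CLT2 \<and> UAN2) \<and> CLT2)"
proof -
  interpret PX: square_integrable_sample PX X Xs
    using assms(1,3-7)
    by (intro square_integrable_sample.intro iid_sample.intro iid_sample_axioms.intro square_integrable_sample_axioms.intro)
  note W = assms(8) and m = assms(9)
  have "M_negligible"
    unfolding M_negligible_def wt_def by (rule tendsto_max_weight_ratio[OF assms(2) W m])
  moreover have CLT
    unfolding CLT_def P_def wt_def data_def
  proof (intro allI)
    fix t
    let ?A = "\<lambda>n k x. T_star n (m n) k (\<lambda>i. Xs i x) \<le> t"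
    show "tendsto_in_prob (PX \<Otimes>\<^sub>M Pw) (\<lambda>n. cond_prob_weights PX Pw n (w n) (\<lambda>x \<omega>. ?A n (\<lambda>i. w n i \<omega>) x))
        (cdf std_normal_distribution t)"
    proof (rule tendsto_in_prob_cond_prob[OF assms(1,2) W m, where A = ?A])
      show "{x \<in> space PX. ?A n k x} \<in> sets PX" for n k by measurable
      show "determined_on n (\<lambda>k. ?A n k x)" for n x
        by (rule determined_on_compose[OF determined_on_T_star])
    qed (assumption | rule PX.T_star_clt)+
  qed
  moreover have CLT2
    unfolding CLT2_def P_def wt_def data_def
  proof (intro allI)
    fix t
    let ?A = "\<lambda>n k x. T_star2 n (m n) k (\<lambda>i. Xs i x) \<le> t"
    show "tendsto_in_prob (PX \<Otimes>\<^sub>M Pw) (\<lambda>n. cond_prob_weights PX Pw n (w n) (\<lambda>x \<omega>. ?A n (\<lambda>i. w n i \<omega>) x))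
        (cdf std_normal_distribution t)"
    proof (rule tendsto_in_prob_cond_prob[OF assms(1,2) W m, where A = ?A])
      show "{x \<in> space PX. ?A n k x} \<in> sets PX" for n k by measurable
      show "determined_on n (\<lambda>k. ?A n k x)" for n x
        by (rule determined_on_compose[OF determined_on_T_star2])
    qed (assumption | rule PX.T_star2_clt)+
  qed
  moreover have UAN
    unfolding UAN_def P_def wt_def data_def
  proof (intro allI impI)
    fix \<epsilon> :: real assume "\<epsilon> > 0"
    let ?A = "\<lambda>n i k x. abs_summand n (m n) k (\<lambda>i. Xs i x) i / (sample_sd n (\<lambda>i. Xs i x) * weight_norm n (m n) k) > \<epsilon>"
    show "tendsto_in_prob (PX \<Otimes>\<^sub>M Pw) (\<lambda>n z. MAX i\<in>{1..n}.
        cond_prob_weights PX Pw n (w n) (\<lambda>x \<omega>. ?A n i (\<lambda>i. w n i \<omega>) x) z) 0"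
    proof (rule tendsto_in_prob_Max_cond_prob[OF assms(1,2) W m, where A = ?A])
      fix n i :: nat and k :: "nat \<Rightarrow> nat" and x assume i: "i \<in> {1..n}"
      note [measurable] = PX.abs_summand_measurable[OF i]
      show "{x \<in> space PX. ?A n i k x} \<in> sets PX" by measurable
      show "determined_on n (\<lambda>k. ?A n i k x)"
        by (rule determined_on_compose2[OF determined_on_abs_summand[OF i] determined_on_weight_norm,
            where h = "\<lambda>a b. a / (sample_sd n (\<lambda>i. Xs i x) * b) > \<epsilon>"])
    next
      fix s k assume k: "balanced_counts s (\<lambda>j. m (s j)) k"
      show "(\<lambda>j. MAX i\<in>{1..s j}. PX.prob {x \<in> space PX. ?A (s j) i (k j) x}) \<longlonglongrightarrow> 0"
        by (rule PX.studentised_uan[OF k \<open>\<epsilon> > 0\<close> PX.sample_sd_measurable PX.sample_sd_tendsto[OF k]])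
    qed assumption
  qed
  moreover have UAN2
    unfolding UAN2_def P_def wt_def data_def
  proof (intro allI impI)
    fix \<epsilon> :: real assume "\<epsilon> > 0"
    let ?A = "\<lambda>n i k x. abs_summand n (m n) k (\<lambda>i. Xs i x) i / (boot_sd n (m n) k (\<lambda>i. Xs i x) / sqrt (real (m n))) > \<epsilon>"
    show "tendsto_in_prob (PX \<Otimes>\<^sub>M Pw) (\<lambda>n z. MAX i\<in>{1..n}.
        cond_prob_weights PX Pw n (w n) (\<lambda>x \<omega>. ?A n i (\<lambda>i. w n i \<omega>) x) z) 0"
    proof (rule tendsto_in_prob_Max_cond_prob[OF assms(1,2) W m, where A = ?A])
      fix n i :: nat and k :: "nat \<Rightarrow> nat" and x assume i: "i \<in> {1..n}"
      note [measurable] = PX.abs_summand_measurable[OF i]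
      show "{x \<in> space PX. ?A n i k x} \<in> sets PX" by measurable
      show "determined_on n (\<lambda>k. ?A n i k x)"
        by (rule determined_on_compose2[OF determined_on_abs_summand[OF i] determined_on_boot_sd,
            where h = "\<lambda>a b. a / (b / sqrt (real (m n))) > \<epsilon>"])
    next
      fix s k assume k: "balanced_counts s (\<lambda>j. m (s j)) k"
      show "(\<lambda>j. MAX i\<in>{1..s j}. PX.prob {x \<in> space PX. ?A (s j) i (k j) x}) \<longlonglongrightarrow> 0"
        unfolding PX.boot_sd_normalised[OF k]
        by (rule PX.studentised_uan[OF k \<open>\<epsilon> > 0\<close> _ PX.scaled_boot_sd_tendsto[OF k]]) measurable
    qed assumption
  qed
  ultimately show ?thesis by blast
qed

end
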